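(* For every $\varepsilon_0 > 0$ there exist an $\varepsilon \in (0, \varepsilon_0)$ and a nonempty finite set $X \subseteq \mathbb{R}^2$ such that the smallest size of an $\varepsilon$-net for the family of intersections of straight lines with $X$, i.e. for the family $\{\ell \cap X : \ell \text{ a straight line in } \mathbb{R}^2\}$, is at least \[ \frac{1}{80\varepsilon} \cdot \sqrt{\frac{\log(1/\varepsilon)}{\log\log(1/\varepsilon)}}. \]
   Context: Given a finite set $X$, a collection $\mathcal{R}$ of subsets of $X$, and $\varepsilon > 0$, an $\varepsilon$-net in (or for) $\mathcal{R}$ is a set $N \subseteq X$ such that $N \cap A \neq \emptyset$ for every $A \in \mathcal{R}$ with $|A| \geq \varepsilon |X|$. $\log$ is the natural logarithm. *)

theory Defs
  imports "HOL-Analysis.Analysis"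
begin

definition eps_net :: "real \<Rightarrow> 'a set \<Rightarrow> 'a set set \<Rightarrow> 'a set \<Rightarrow> bool" where
  "eps_net \<epsilon> X R N \<longleftrightarrow>
     N \<subseteq> X \<and> (\<forall>A\<in>R. real (card A) \<ge> \<epsilon> * real (card X) \<longrightarrow> N \<inter> A \<noteq> {})"

text \<open>The least element exists whenever \<open>X\<close> is finite and nonempty, \<open>\<epsilon> > 0\<close> and all members of
  \<open>R\<close> are subsets of \<open>X\<close>; see \<open>eps_net_self\<close> and \<open>eps_net_number_attained\<close> below.\<close>

definition eps_net_number :: "real \<Rightarrow> 'a set \<Rightarrow> 'a set set \<Rightarrow> nat" where
  "eps_net_number \<epsilon> X R = (LEAST k. \<exists>N. eps_net \<epsilon> X R N \<and> card N = k)"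

definition straight_line :: "(real ^ 2) set \<Rightarrow> bool" where
  "straight_line l \<longleftrightarrow> affine l \<and> aff_dim l = 1"

definition line_ranges :: "(real ^ 2) set \<Rightarrow> (real ^ 2) set set" where
  "line_ranges X = {l \<inter> X | l. straight_line l}"

lemma eps_net_self:
  assumes "finite X" "X \<noteq> {}" "\<epsilon> > 0" "\<And>A. A \<in> R \<Longrightarrow> A \<subseteq> X"
  shows "eps_net \<epsilon> X R X"
  unfolding eps_net_def
proof (intro conjI ballI impI)
  fix A assume A: "A \<in> R" and le: "real (card A) \<ge> \<epsilon> * real (card X)"
  have "\<epsilon> * real (card X) > 0"
    using assms by (simp add: card_gt_0_iff)
  with le have "A \<noteq> {}" by auto
  then show "X \<inter> A \<noteq> {}" using assms(4)[OF A] by auto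
qed simp

lemma eps_net_number_attained:
  assumes "finite X" "X \<noteq> {}" "\<epsilon> > 0" "\<And>A. A \<in> R \<Longrightarrow> A \<subseteq> X"
  shows "\<exists>N. eps_net \<epsilon> X R N \<and> card N = eps_net_number \<epsilon> X R"
  unfolding eps_net_number_def
  by (rule LeastI_ex) (use eps_net_self[OF assms] in blast)

end

theory Submission
  imports Defs
begin

text \<open>Fix a large \<open>k\<close>. The set \<open>X\<close> is a sparse random subset of an integer grid, and only the lines
\<open>y = a x + b\<close> with slope \<open>0 \<le> a < s\<close> matter. Call a set of grid points independent if each of these
lines contains fewer than \<open>k\<close> of its points. For a suitable number \<open>M\<close>, there is an \<open>X\<close> with
about \<open>M\<close> points such that

 \<^item> none of these lines contains more than \<open>k\<close> points of \<open>X\<close>, and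
 \<^item> no subset of \<open>X\<close> with at least \<open>M/2\<close> points is independent.

Let \<open>\<epsilon> = k / |X|\<close> and let \<open>N\<close> be an \<open>\<epsilon>\<close>-net. If \<open>X - N\<close> had \<open>k\<close> points on one of the
lines, these would be all the points of \<open>X\<close> on that line, so \<open>N\<close> would miss a range of size
\<open>\<epsilon> |X|\<close>. Hence \<open>X - N\<close> is independent, so \<open>|X - N| < M/2\<close> and \<open>|N| \<ge> |X|/3 = k / (3\<epsilon>)\<close>. The
parameters give \<open>ln (1/\<epsilon>) = O(k\<^sup>2 ln k)\<close> and \<open>ln (1/\<epsilon>) \<ge> k\<close>, so \<open>k\<close> is at least a constant
times the square root in the statement.

The first property follows by deletion (\<open>exists_configuration\<close>): a line is expected to contain far
fewer than one of the random points. The second property must survive a union bound over \<open>2\<^sup>M\<close>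
subsets, so the probability that \<open>M/2\<close> random points form an independent set has to be at most
\<open>C\<^sup>-\<^sup>M\<close> for some constant \<open>C > 2\<close>. This is \<open>count_independent\<close>, which is in essence a hypergraph
container argument. Expose the points one at a time and keep a set \<open>T\<close> of some of those already seen. Let
\<open>Z T\<close> be the partition function of the hard-core model given \<open>T\<close>: the sum of \<open>\<lambda>\<^bsup>|S|\<^esup>\<close> over all grid
sets \<open>S\<close> for which \<open>S \<union> T\<close> is independent, where \<open>\<lambda>\<close> is the \<open>fugacity\<close>. A new point that lowers \<open>Z T\<close> at least by the factor \<open>1 - 1/(4k)\<close>
is added to \<open>T\<close>; since \<open>1 \<le> Z T \<le> (1 + \<lambda>)\<^sup>n\<close>, where \<open>n\<close> is the number of grid points, this happens
rarely. Every other point lies in the set \<open>harmless T\<close>, which by \<open>harmless_small\<close> is only a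
\<open>1/256\<close> fraction of the grid.

Finally, \<open>harmless_small\<close> holds for the following reason. Draw \<open>S\<close> from the hard-core measure given
\<open>T\<close>. If there were many harmless points, one of them, \<open>v\<close>, would lie on many lines that each carry
\<open>k - 1\<close> further harmless points. Two lines share at most one point, so these groups of
\<open>k - 1\<close> points interact so weakly with the rest that each of them lies in \<open>S\<close> almost as often as in
an unconditioned random set (\<open>Z_add_collinear\<close>). By a second moment computation \<open>S\<close> then contains one
of the groups with probability at least \<open>1/8\<close>. In that event \<open>S \<union> T\<close> cannot be extended by \<open>v\<close>,
whereas a harmless point is blocked with probability less than \<open>1/(4k)\<close> only. The dependence on \<open>k\<close> in
every step is polynomial, and this is what makes \<open>ln (1/\<epsilon>)\<close> quadratic in \<open>k\<close> up to the logarithm.\<close>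

section \<open>Independent sets in partial linear spaces\<close>

text \<open>The bound \<open>card_I\<close> allows a factor 2 for lines that leave a finite grid early; together with
\<open>long_lines\<close> it ensures that lines with fewer than \<open>k\<close> points of a set of more than \<open>|V|/256\<close> points carry
only a small part of the incidences of that set.\<close>
locale regular_line_system =
  fixes V :: "'a set" and I :: "'i set" and line :: "'i \<Rightarrow> 'a set" and s A k :: nat
  assumes finite_V: "finite V"
    and finite_I: "finite I"
    and line_subset: "i \<in> I \<Longrightarrow> line i \<subseteq> V"
    and line_meet: "\<lbrakk>i \<in> I; j \<in> I; i \<noteq> j; u \<in> line i; u \<in> line j; v \<in> line i; v \<in> line j\<rbrakk> \<Longrightarrow> u = v"
    and card_line: "i \<in> I \<Longrightarrow> card (line i) \<le> A"
    and degree: "v \<in> V \<Longrightarrow> card {i \<in> I. v \<in> line i} = s"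
    and card_I: "A * card I \<le> 2 * s * card V"
    and long_lines: "2048 * k \<le> A"
    and k_ge_3: "3 \<le> k"
begin

definition ind :: "'a set \<Rightarrow> bool" where
  "ind S \<longleftrightarrow> (\<forall>i\<in>I. card (S \<inter> line i) < k)"

lemma finite_line: "i \<in> I \<Longrightarrow> finite (line i)"
  using finite_subset[OF line_subset finite_V] .

lemma ind_mono: "ind S \<Longrightarrow> S' \<subseteq> S \<Longrightarrow> ind S'"
  unfolding ind_def
proof
  fix i assume *: "\<forall>i\<in>I. card (S \<inter> line i) < k" "S' \<subseteq> S" "i \<in> I"
  have "card (S' \<inter> line i) \<le> card (S \<inter> line i)"
    using finite_line[OF *(3)] *(2) by (intro card_mono) auto
  then show "card (S' \<inter> line i) < k" using *(1,3) by force
qed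

lemma incidences:
  assumes "C \<subseteq> V" "I' \<subseteq> I"
  shows "(\<Sum>v\<in>C. card {i \<in> I'. v \<in> line i}) = (\<Sum>i\<in>I'. card (line i \<inter> C))"
proof -
  have fC: "finite C" and fI: "finite I'"
    using assms finite_V finite_I finite_subset by auto
  have "(\<Sum>v\<in>C. card {i \<in> I'. v \<in> line i}) = (\<Sum>v\<in>C. \<Sum>i\<in>I'. if v \<in> line i then 1 else 0)"
    by (simp only: card_eq_sum sum.inter_filter[OF fI])
  also have "\<dots> = (\<Sum>i\<in>I'. \<Sum>v\<in>C. if v \<in> line i then 1 else 0)"
    by (rule sum.swap)
  also have "\<dots> = (\<Sum>i\<in>I'. card {v \<in> C. v \<in> line i})"
    by (simp only: card_eq_sum sum.inter_filter[OF fC])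
  also have "\<dots> = (\<Sum>i\<in>I'. card (line i \<inter> C))"
    by (intro sum.cong refl arg_cong[where f = card]) auto
  finally show ?thesis .
qed

lemma card_lines_meeting:
  assumes "T \<subseteq> V"
  shows "card {i \<in> I. line i \<inter> T \<noteq> {}} \<le> s * card T"
proof -
  have fT: "finite T" using assms finite_V finite_subset by auto
  have "{i \<in> I. line i \<inter> T \<noteq> {}} = (\<Union>v\<in>T. {i \<in> I. v \<in> line i})" by auto
  then have "card {i \<in> I. line i \<inter> T \<noteq> {}} \<le> (\<Sum>v\<in>T. card {i \<in> I. v \<in> line i})"
    using card_UN_le[OF fT, of "\<lambda>v. {i \<in> I. v \<in> line i}"] by simp
  also have "\<dots> = (\<Sum>v\<in>T. s)"
    using degree assms by (intro sum.cong refl) blast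
  finally show ?thesis by (simp add: mult.commute)
qed

text \<open>Double counting: of the \<open>s |C|\<close> incidences of \<open>C\<close>, at most a quarter lie on lines that meet the
small set \<open>T\<close>, and at most a quarter on lines that are poor in points of \<open>C\<close>.\<close>
lemma rich_point:
  assumes C: "C \<subseteq> V" and T: "T \<subseteq> V" and big: "card V < 256 * card C"
    and small: "1024 * A * card T \<le> card V"
  shows "\<exists>v\<in>C. s \<le> 2 * card {i \<in> I. v \<in> line i \<and> line i \<inter> T = {} \<and> k \<le> card (line i \<inter> C)}"
proof (rule ccontr)
  assume "\<not> ?thesis"
  then have less: "2 * card {i \<in> I. v \<in> line i \<and> line i \<inter> T = {} \<and> k \<le> card (line i \<inter> C)} < s"
    if "v \<in> C" for v using that by (meson not_le)
  define Good where "Good = {i \<in> I. line i \<inter> T = {} \<and> k \<le> card (line i \<inter> C)}"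
  define Touch where "Touch = {i \<in> I. line i \<inter> T \<noteq> {}}"
  define Poor where "Poor = {i \<in> I. line i \<inter> T = {} \<and> card (line i \<inter> C) < k}"
  have split: "I = Good \<union> (Touch \<union> Poor)" unfolding Good_def Touch_def Poor_def by auto
  have fin: "finite Good" "finite Touch" "finite Poor"
    using finite_I unfolding Good_def Touch_def Poor_def by auto
  have disj: "Good \<inter> (Touch \<union> Poor) = {}" "Touch \<inter> Poor = {}"
    unfolding Good_def Touch_def Poor_def by auto
  have fC: "finite C" using finite_subset[OF C finite_V] .
  have Cne: "C \<noteq> {}" using big by auto
  have "s * card C = (\<Sum>v\<in>C. s)" by (simp add: mult.commute)
  also have "\<dots> = (\<Sum>v\<in>C. card {i \<in> I. v \<in> line i})"
    using degree C by (intro sum.cong refl) (metis subsetD)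
  also have "\<dots> = (\<Sum>i\<in>I. card (line i \<inter> C))"
    by (rule incidences[OF C order_refl])
  also have "\<dots> = (\<Sum>i\<in>Good. card (line i \<inter> C)) + (\<Sum>i\<in>Touch \<union> Poor. card (line i \<inter> C))"
    by (subst split, rule sum.union_disjoint) (use fin disj in auto)
  also have "(\<Sum>i\<in>Touch \<union> Poor. card (line i \<inter> C)) = (\<Sum>i\<in>Touch. card (line i \<inter> C)) + (\<Sum>i\<in>Poor. card (line i \<inter> C))"
    by (rule sum.union_disjoint) (use fin disj in auto)
  finally have total: "s * card C = (\<Sum>i\<in>Good. card (line i \<inter> C)) + ((\<Sum>i\<in>Touch. card (line i \<inter> C)) + (\<Sum>i\<in>Poor. card (line i \<inter> C)))" .
  have "(\<Sum>i\<in>Good. card (line i \<inter> C)) = (\<Sum>v\<in>C. card {i \<in> Good. v \<in> line i})"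
    by (rule incidences[symmetric, OF C]) (auto simp: Good_def)
  also have "2 * \<dots> = (\<Sum>v\<in>C. 2 * card {i \<in> Good. v \<in> line i})"
    by (rule sum_distrib_left)
  also have "\<dots> < (\<Sum>v\<in>C. s)"
  proof (rule sum_strict_mono[OF fC Cne])
    fix v assume "v \<in> C"
    have "{i \<in> Good. v \<in> line i} = {i \<in> I. v \<in> line i \<and> line i \<inter> T = {} \<and> k \<le> card (line i \<inter> C)}"
      unfolding Good_def by auto
    then show "2 * card {i \<in> Good. v \<in> line i} < s" using less[OF \<open>v \<in> C\<close>] by simp
  qed
  finally have good: "2 * (\<Sum>i\<in>Good. card (line i \<inter> C)) < s * card C" by (simp add: mult.commute)
  have "(\<Sum>i\<in>Touch. card (line i \<inter> C)) \<le> (\<Sum>i\<in>Touch. A)"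
  proof (rule sum_mono)
    fix i assume "i \<in> Touch"
    then have i: "i \<in> I" unfolding Touch_def by auto
    show "card (line i \<inter> C) \<le> A"
      by (rule le_trans[OF card_mono[OF finite_line[OF i] Int_lower1] card_line[OF i]])
  qed
  also have "\<dots> \<le> s * card T * A"
    using card_lines_meeting[OF T] by (simp add: Touch_def)
  finally have "1024 * (\<Sum>i\<in>Touch. card (line i \<inter> C)) \<le> s * (1024 * A * card T)"
    by (simp add: algebra_simps)
  also have "\<dots> \<le> s * card V" by (rule mult_le_mono2[OF small])
  finally have touch: "1024 * (\<Sum>i\<in>Touch. card (line i \<inter> C)) \<le> s * card V" .
  have "(\<Sum>i\<in>Poor. card (line i \<inter> C)) \<le> (\<Sum>i\<in>Poor. k)"
    by (rule sum_mono) (auto simp: Poor_def)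
  also have "\<dots> \<le> k * card I"
    using card_mono[OF finite_I, of Poor] by (simp add: Poor_def mult.commute)
  finally have "2048 * (\<Sum>i\<in>Poor. card (line i \<inter> C)) \<le> (2048 * k) * card I" by simp
  also have "\<dots> \<le> A * card I" by (rule mult_le_mono1[OF long_lines])
  also have "\<dots> \<le> 2 * (s * card V)" using card_I by simp
  finally have poor: "1024 * (\<Sum>i\<in>Poor. card (line i \<inter> C)) \<le> s * card V" by simp
  have CV: "s * card V \<le> 256 * (s * card C)"
    using big mult_le_mono2[of "card V" "256 * card C" s] by simp
  have arith: False if "S = a + (b + c)" "2 * a < S" "1024 * b \<le> W" "1024 * c \<le> W" "W \<le> 256 * S"
    for S W a b c :: nat using that by linarith
  show False by (rule arith[OF total good touch poor CV])
qed

end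

section \<open>The hard-core model\<close>

text \<open>Here \<open>1/P\<close> is the density of the unconditioned random set of the hard-core model. The degree \<open>s\<close>
is chosen so that \<open>s/2\<close> groups of \<open>k - 1\<close> points have exactly one member, on average, inside such a
random set. The bound \<open>P_big\<close> keeps the recorded set \<open>T\<close> of \<open>card_fingerprint_le\<close> as small as
\<open>rich_point\<close> requires.\<close>
locale hard_core = regular_line_system V I line s A k
  for V :: "'a set" and I :: "'i set" and line :: "'i \<Rightarrow> 'a set" and s A k :: nat +
  fixes P :: nat
  assumes P_big: "4096 * k * A < P"
    and s_eq: "s = 2 * P ^ (k - 1)"
begin

lemma k_pos: "0 < k" and A_pos: "0 < A"
  using long_lines k_ge_3 by linarith+

lemma P_ge: "8 * A \<le> P" and P_gt_1: "1 < P"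
proof -
  have "1 * A \<le> k * A" using k_pos by (intro mult_le_mono1) simp
  then show "8 * A \<le> P" "1 < P" using P_big A_pos by linarith+
qed

text \<open>With this weight per point, including each point independently with probability \<open>1/P\<close> gives a set
\<open>S\<close> with probability proportional to \<open>fugacity ^ card S\<close>.\<close>
definition fugacity :: real where "fugacity = 1 / (real P - 1)"

lemma fugacity_pos: "0 < fugacity" and fugacity_ratio: "fugacity / (1 + fugacity) = 1 / real P"
  using P_gt_1 unfolding fugacity_def by (auto simp: field_simps)

definition W :: "'a set set \<Rightarrow> real" where
  "W \<S> = (\<Sum>S \<in> \<S> \<inter> Pow V. fugacity ^ card S)"

lemma finite_Pow_V: "finite (\<S> \<inter> Pow V)"
  using finite_V by simp

lemma W_mono:
  assumes "\<And>S. S \<subseteq> V \<Longrightarrow> S \<in> \<S> \<Longrightarrow> S \<in> \<T>" shows "W \<S> \<le> W \<T>"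
  unfolding W_def using assms fugacity_pos finite_Pow_V by (intro sum_mono2) auto

lemma W_nonneg: "0 \<le> W \<S>"
  unfolding W_def using fugacity_pos by (intro sum_nonneg) auto

lemma W_indicator: "W \<S> = (\<Sum>S \<in> Pow V. indicator \<S> S * fugacity ^ card S)"
proof -
  have "\<S> \<inter> Pow V = {S \<in> Pow V. S \<in> \<S>}" by auto
  then have "W \<S> = (\<Sum>S \<in> Pow V. if S \<in> \<S> then fugacity ^ card S else 0)"
    unfolding W_def using sum.inter_filter[of "Pow V"] finite_V by simp
  also have "\<dots> = (\<Sum>S \<in> Pow V. indicator \<S> S * fugacity ^ card S)"
    by (intro sum.cong) (auto simp: indicator_def)
  finally show ?thesis .
qed

lemma W_Un_le: "W (\<S> \<union> \<T>) \<le> W \<S> + W \<T>"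
proof -
  have "W (\<S> \<union> \<T>) \<le> (\<Sum>S \<in> Pow V. indicator \<S> S * fugacity ^ card S + indicator \<T> S * fugacity ^ card S)"
    unfolding W_indicator using fugacity_pos by (intro sum_mono) (auto simp: indicator_def)
  also have "\<dots> = W \<S> + W \<T>" unfolding W_indicator by (rule sum.distrib)
  finally show ?thesis .
qed

lemma W_UN_le:
  assumes "finite J" shows "W (\<Union>j\<in>J. \<S> j) \<le> (\<Sum>j\<in>J. W (\<S> j))"
  using assms
proof (induction J)
  case empty then show ?case by (simp add: W_def)
next
  case (insert j J)
  have "W (\<Union>j\<in>insert j J. \<S> j) \<le> W (\<S> j) + W (\<Union>j\<in>J. \<S> j)"
    using W_Un_le by simp
  then show ?case using insert by simp
qed

lemma W_point:
  assumes v: "v \<in> V"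
  shows "W {S. v \<in> S \<and> Q S} = 1 / real P * W {S. Q (insert v S)}"
proof -
  define U where "U = {S. S \<subseteq> V \<and> v \<notin> S \<and> Q (insert v S)}"
  define a where "a = (\<Sum>S\<in>U. fugacity ^ card S)"
  have fin: "finite S" if "S \<in> U" for S
    using that finite_V finite_subset unfolding U_def by auto
  have finU: "finite U" unfolding U_def using finite_V by simp
  have img: "{S. v \<in> S \<and> Q S} \<inter> Pow V = insert v ` U"
  proof (intro equalityI subsetI)
    fix S assume "S \<in> {S. v \<in> S \<and> Q S} \<inter> Pow V"
    then have "S - {v} \<in> U" "S = insert v (S - {v})" unfolding U_def by (auto simp: insert_absorb)
    then show "S \<in> insert v ` U" by blast
  qed (use v in \<open>auto simp: U_def\<close>)
  have inj: "inj_on (insert v) U" by (rule inj_onI) (auto simp: U_def insert_ident)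
  have 1: "W {S. v \<in> S \<and> Q S} = fugacity * a"
  proof -
    have "W {S. v \<in> S \<and> Q S} = (\<Sum>S\<in>U. fugacity ^ card (insert v S))"
      unfolding W_def img by (simp add: sum.reindex[OF inj])
    also have "\<dots> = (\<Sum>S\<in>U. fugacity * fugacity ^ card S)"
      using fin by (intro sum.cong refl) (auto simp: U_def)
    finally show ?thesis by (simp add: a_def sum_distrib_left)
  qed
  have "{S. Q (insert v S)} \<inter> Pow V = ({S. v \<in> S \<and> Q S} \<inter> Pow V) \<union> U"
    unfolding U_def by (auto simp: insert_absorb)
  then have "W {S. Q (insert v S)} = W {S. v \<in> S \<and> Q S} + a"
    unfolding W_def a_def using finU finite_V by (simp add: sum.union_disjoint U_def disjoint_iff)
  then have "W {S. Q (insert v S)} = (1 + fugacity) * a" using 1 by (simp add: algebra_simps)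
  moreover have "fugacity = 1 / real P * (1 + fugacity)" using fugacity_ratio fugacity_pos by (simp add: field_simps)
  ultimately show ?thesis using 1 by (metis mult.assoc)
qed

text \<open>Under the product measure the event \<open>F \<subseteq> S\<close> is independent of what happens outside \<open>F\<close>, so
planting \<open>F\<close> in \<open>S\<close> only costs the factor \<open>P\<close> per point.\<close>
lemma W_superset:
  assumes "finite F" "F \<subseteq> V"
  shows "W {S. F \<subseteq> S \<and> Q S} = (1 / real P) ^ card F * W {S. Q (S \<union> F)}"
  using assms
proof (induction F arbitrary: Q)
  case empty then show ?case by simp
next
  case (insert v F)
  have "W {S. insert v F \<subseteq> S \<and> Q S} = W {S. v \<in> S \<and> (F \<subseteq> S \<and> Q S)}" by (simp add: conj_assoc)
  also have "\<dots> = 1 / real P * W {S. F \<subseteq> insert v S \<and> Q (insert v S)}"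
    using insert.prems by (intro W_point) auto
  also have "{S. F \<subseteq> insert v S \<and> Q (insert v S)} = {S. F \<subseteq> S \<and> Q (insert v S)}"
    using insert.hyps by auto
  also have "W \<dots> = (1 / real P) ^ card F * W {S. Q (insert v (S \<union> F))}"
    using insert.prems by (intro insert.IH) auto
  finally show ?case using insert.hyps by simp
qed

definition Z :: "'a set \<Rightarrow> real" where
  "Z T = W {S. ind (S \<union> T)}"

lemma Z_nonneg: "0 \<le> Z T"
  unfolding Z_def by (rule W_nonneg)

lemma Z_antimono: "T \<subseteq> T' \<Longrightarrow> Z T' \<le> Z T"
  unfolding Z_def by (rule W_mono) (auto elim: ind_mono)

lemma Z_ge_1:
  assumes "ind T" shows "1 \<le> Z T"
proof -
  have "{{}} \<inter> Pow V = {{}}" by auto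
  then have "1 = W {{}}" by (simp add: W_def)
  also have "\<dots> \<le> Z T" unfolding Z_def using assms by (intro W_mono) auto
  finally show ?thesis .
qed

lemma Z_le: "Z T \<le> (1 + fugacity) ^ card V"
proof -
  have "Z T \<le> W UNIV" unfolding Z_def by (rule W_mono) auto
  also have "\<dots> = (\<Prod>v\<in>V. fugacity + 1)"
    unfolding W_def using prod_add[OF finite_V, of "\<lambda>_. fugacity" "\<lambda>_. 1"] by simp
  finally show ?thesis by (simp add: add.commute)
qed

lemma W_ind_superset:
  assumes "F \<subseteq> V"
  shows "W {S. F \<subseteq> S \<and> ind (S \<union> T)} = (1 / real P) ^ card F * Z (F \<union> T)"
  using W_superset[of F "\<lambda>S. ind (S \<union> T)"] assms finite_subset[OF assms finite_V]
  by (simp add: Z_def Un_assoc)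

lemma W_diff:
  assumes "\<And>S. S \<subseteq> V \<Longrightarrow> Q S \<Longrightarrow> R S"
  shows "W {S. R S \<and> \<not> Q S} = W {S. R S} - W {S. Q S}"
proof -
  have "{S. R S} \<inter> Pow V = ({S. R S \<and> \<not> Q S} \<inter> Pow V) \<union> ({S. Q S} \<inter> Pow V)"
    using assms by auto
  then have "W {S. R S} = W {S. R S \<and> \<not> Q S} + W {S. Q S}"
    unfolding W_def using finite_V by (simp add: sum.union_disjoint disjoint_iff)
  then show ?thesis by simp
qed

text \<open>A Bonferroni inequality: if \<open>m\<close> counts the events that occur, then \<open>3 m - m\<^sup>2 \<le> 2\<close> because no integer
lies strictly between 1 and 2, and the left side is 0 for \<open>m = 0\<close>.\<close>
lemma W_second_moment:
  assumes "finite J"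
  shows "3 * (\<Sum>j\<in>J. W (\<S> j)) - (\<Sum>i\<in>J. \<Sum>j\<in>J. W (\<S> i \<inter> \<S> j)) \<le> 2 * W (\<Union>j\<in>J. \<S> j)"
proof -
  let ?N = "\<lambda>S. \<Sum>j\<in>J. indicator (\<S> j) S :: real"
  have sq: "(\<Sum>i\<in>J. \<Sum>j\<in>J. indicator (\<S> i \<inter> \<S> j) S) = ?N S * ?N S" for S
    by (simp add: sum_product indicator_inter_arith)
  have pointwise: "3 * ?N S - ?N S * ?N S \<le> 2 * indicator (\<Union>j\<in>J. \<S> j) S" for S
  proof (cases "S \<in> (\<Union>j\<in>J. \<S> j)")
    case True
    have "?N S = real (card {j \<in> J. S \<in> \<S> j})"
      using assms by (simp add: indicator_def sum.If_cases Int_def)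
    then obtain m :: nat where m: "?N S = real m" by blast
    consider "m = 0" | "m = 1" | "2 \<le> m" by linarith
    then have "0 \<le> (real m - 1) * (real m - 2)"
      by cases (auto intro: mult_nonneg_nonneg)
    then show ?thesis using True unfolding m by (simp add: algebra_simps)
  next
    case False
    then have "?N S = 0" by (intro sum.neutral) (auto simp: indicator_def)
    then show ?thesis by simp
  qed
  have "3 * (\<Sum>j\<in>J. W (\<S> j)) = (\<Sum>S\<in>Pow V. 3 * ?N S * fugacity ^ card S)"
    unfolding W_indicator
    by (subst sum.swap) (simp add: sum_distrib_left sum_distrib_right mult.assoc)
  moreover have "(\<Sum>i\<in>J. \<Sum>j\<in>J. W (\<S> i \<inter> \<S> j)) = (\<Sum>S\<in>Pow V. ?N S * ?N S * fugacity ^ card S)"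
  proof -
    have "(\<Sum>i\<in>J. \<Sum>j\<in>J. W (\<S> i \<inter> \<S> j))
        = (\<Sum>i\<in>J. \<Sum>S\<in>Pow V. \<Sum>j\<in>J. indicator (\<S> i \<inter> \<S> j) S * fugacity ^ card S)"
      unfolding W_indicator by (subst sum.swap) (rule refl)
    also have "\<dots> = (\<Sum>S\<in>Pow V. \<Sum>i\<in>J. \<Sum>j\<in>J. indicator (\<S> i \<inter> \<S> j) S * fugacity ^ card S)"
      by (rule sum.swap)
    also have "\<dots> = (\<Sum>S\<in>Pow V. ?N S * ?N S * fugacity ^ card S)"
      by (simp only: sq[symmetric]) (simp only: sum_distrib_right)
    finally show ?thesis .
  qed
  ultimately have "3 * (\<Sum>j\<in>J. W (\<S> j)) - (\<Sum>i\<in>J. \<Sum>j\<in>J. W (\<S> i \<inter> \<S> j))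
      = (\<Sum>S\<in>Pow V. (3 * ?N S - ?N S * ?N S) * fugacity ^ card S)"
    by (simp add: sum_subtractf left_diff_distrib)
  also have "\<dots> \<le> (\<Sum>S\<in>Pow V. 2 * indicator (\<Union>j\<in>J. \<S> j) S * fugacity ^ card S)"
    using fugacity_pos pointwise by (intro sum_mono mult_right_mono) auto
  also have "\<dots> = 2 * W (\<Union>j\<in>J. \<S> j)"
    unfolding W_indicator by (simp add: sum_distrib_left mult.assoc)
  finally show ?thesis .
qed

end

section \<open>Harmless points are rare\<close>

context hard_core
begin

definition \<delta> :: real where "\<delta> = 1 / (4 * real k)"

text \<open>Equivalently, a set drawn from the hard-core measure given \<open>T\<close> remains independent after adding
\<open>v\<close> with probability more than \<open>1 - \<delta>\<close>.\<close>
definition harmless :: "'a set \<Rightarrow> 'a set" where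
  "harmless T = {v \<in> V. (1 - \<delta>) * Z T < Z (insert v T)}"

lemma W_blocked_less:
  assumes "v \<in> harmless T"
  shows "W {S. ind (S \<union> T) \<and> \<not> ind (insert v (S \<union> T))} < \<delta> * Z T"
proof -
  have "W {S. ind (S \<union> T) \<and> \<not> ind (insert v (S \<union> T))} = W {S. ind (S \<union> T)} - W {S. ind (insert v (S \<union> T))}"
    by (rule W_diff) (auto elim: ind_mono)
  also have "\<dots> = Z T - Z (insert v T)" by (simp add: Z_def)
  finally show ?thesis using assms unfolding harmless_def by (simp add: algebra_simps)
qed

text \<open>Let \<open>S\<close> be drawn from the hard-core measure given \<open>T\<close>. Adding all of \<open>F\<close> to \<open>S\<close> can fail
only if some single point of \<open>F\<close> is already blocked, or if the line \<open>i\<close> itself contains a point of \<open>S\<close>: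
every other line sees at most one point of \<open>F\<close>. The first has probability at most
\<open>(k - 1) \<delta> \<le> 1/4\<close>, the second at most \<open>A/P \<le> 1/8\<close>.\<close>
lemma Z_add_collinear:
  assumes i: "i \<in> I" and F: "F \<subseteq> line i" "card F = k - 1" "F \<subseteq> harmless T"
    and disjoint: "line i \<inter> T = {}"
  shows "5/8 * Z T \<le> Z (F \<union> T)"
proof -
  define B where "B u = {S. ind (S \<union> T) \<and> \<not> ind (insert u (S \<union> T))}" for u
  define H where "H u = {S. {u} \<subseteq> S \<and> ind (S \<union> T)}" for u
  have finF: "finite F" using finite_subset[OF F(1) finite_line[OF i]] .
  have cover: "{S. ind (S \<union> T) \<and> \<not> ind (S \<union> (F \<union> T))} \<subseteq> (\<Union>u\<in>F. B u) \<union> (\<Union>u\<in>line i. H u)"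
  proof (rule ccontr)
    assume "\<not> ?thesis"
    then obtain S where S: "ind (S \<union> T)" "\<not> ind (S \<union> (F \<union> T))"
      and notB: "\<And>u. u \<in> F \<Longrightarrow> S \<notin> B u" and notH: "\<And>u. u \<in> line i \<Longrightarrow> S \<notin> H u" by blast
    have ins: "ind (insert u (S \<union> T))" if "u \<in> F" for u
      using notB[OF that] S(1) unfolding B_def by auto
    have Si: "S \<inter> line i = {}" using notH S(1) unfolding H_def by auto
    obtain j where j: "j \<in> I" "k \<le> card ((S \<union> (F \<union> T)) \<inter> line j)"
      using S(2) unfolding ind_def by force
    show False
    proof (cases "j = i")
      case True
      then have "(S \<union> (F \<union> T)) \<inter> line j = F" using Si F(1) disjoint by auto
      then show False using j(2) F(2) k_pos by simp
    next
      case False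
      \<comment> \<open>A second line contains at most one point of \<open>F\<close>.\<close>
      have "\<exists>u. F \<inter> line j \<subseteq> {u}"
      proof (cases "F \<inter> line j = {}")
        case False
        then obtain u where u: "u \<in> F" "u \<in> line j" by auto
        then have "F \<inter> line j \<subseteq> {u}"
          using line_meet[OF i j(1)] F(1) \<open>j \<noteq> i\<close> by blast
        then show ?thesis by blast
      qed auto
      then obtain u where u: "F \<inter> line j \<subseteq> {u}" by blast
      define G where "G = (if u \<in> F then insert u (S \<union> T) else S \<union> T)"
      have "ind G" using ins S(1) unfolding G_def by auto
      moreover have "(S \<union> (F \<union> T)) \<inter> line j \<subseteq> G \<inter> line j" using u unfolding G_def by auto
      then have "card ((S \<union> (F \<union> T)) \<inter> line j) \<le> card (G \<inter> line j)"
        using finite_line[OF j(1)] by (intro card_mono) auto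
      ultimately show False using j unfolding ind_def by force
    qed
  qed
  have "Z T - Z (F \<union> T) = W {S. ind (S \<union> T) \<and> \<not> ind (S \<union> (F \<union> T))}"
    unfolding Z_def by (rule W_diff[symmetric]) (auto elim: ind_mono)
  also have "\<dots> \<le> W ((\<Union>u\<in>F. B u) \<union> (\<Union>u\<in>line i. H u))"
    using cover by (intro W_mono) auto
  also have "\<dots> \<le> W (\<Union>u\<in>F. B u) + W (\<Union>u\<in>line i. H u)" by (rule W_Un_le)
  also have "W (\<Union>u\<in>F. B u) \<le> (\<Sum>u\<in>F. W (B u))" by (rule W_UN_le[OF finF])
  also have "(\<Sum>u\<in>F. W (B u)) \<le> (\<Sum>u\<in>F. \<delta> * Z T)"
    using W_blocked_less F(3) unfolding B_def by (intro sum_mono less_imp_le) auto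
  also have "(\<Sum>u\<in>F. \<delta> * Z T) = real (k - 1) * \<delta> * Z T" using F(2) by simp
  also have "\<dots> \<le> 1/4 * Z T"
    using k_pos unfolding \<delta>_def by (intro mult_right_mono[OF _ Z_nonneg]) (simp add: field_simps)
  also have "W (\<Union>u\<in>line i. H u) \<le> (\<Sum>u\<in>line i. W (H u))" by (rule W_UN_le[OF finite_line[OF i]])
  also have "(\<Sum>u\<in>line i. W (H u)) \<le> (\<Sum>u\<in>line i. 1 / real P * Z T)"
  proof (rule sum_mono)
    fix u assume "u \<in> line i"
    then have "W (H u) = 1 / real P * Z ({u} \<union> T)"
      unfolding H_def using line_subset[OF i] by (subst W_ind_superset) auto
    also have "\<dots> \<le> 1 / real P * Z T" by (intro mult_left_mono Z_antimono) auto
    finally show "W (H u) \<le> 1 / real P * Z T" .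
  qed
  also have "(\<Sum>u\<in>line i. 1 / real P * Z T) = real (card (line i)) / real P * Z T" by simp
  also have "\<dots> \<le> 1/8 * Z T"
  proof (rule mult_right_mono[OF _ Z_nonneg])
    have "8 * card (line i) \<le> P" using card_line[OF i] P_ge by linarith
    then have "8 * real (card (line i)) \<le> real P" by (metis of_nat_le_iff of_nat_mult of_nat_numeral)
    then show "real (card (line i)) / real P \<le> 1/8" using P_gt_1 by (simp add: field_simps)
  qed
  finally show ?thesis by simp
qed

text \<open>If the claim fails, some harmless \<open>v\<close> lies on \<open>d = P ^ (k - 1)\<close> lines that avoid \<open>T\<close> and carry a set
\<open>F i\<close> of \<open>k - 1\<close> other harmless points. Each \<open>F i\<close> is contained in the random set with
probability between \<open>5/8 / d\<close> and \<open>1 / d\<close>, each pair of them with probability at most \<open>1 / d\<^sup>2\<close>,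
so some \<open>F i\<close> is contained with probability at least \<open>5/8 - 1/2\<close>. This event blocks \<open>v\<close>.\<close>
lemma harmless_small:
  assumes T: "T \<subseteq> V" "1024 * A * card T \<le> card V" and ind: "ind T"
  shows "256 * card (harmless T) \<le> card V"
proof (rule ccontr)
  assume "\<not> ?thesis"
  then have big: "card V < 256 * card (harmless T)" by simp
  have sub: "harmless T \<subseteq> V" unfolding harmless_def by auto
  obtain v where v: "v \<in> harmless T"
    and many: "s \<le> 2 * card {i \<in> I. v \<in> line i \<and> line i \<inter> T = {} \<and> k \<le> card (line i \<inter> harmless T)}"
    using rich_point[OF sub T(1) big T(2)] by blast
  define d where "d = P ^ (k - 1)"
  define q where "q = (1 / real P) ^ (k - 1)"
  have dq: "real d * q = 1" unfolding d_def q_def using P_gt_1 by (simp add: power_one_over)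
  then have qd: "q * real d = 1" by (simp add: mult.commute)
  have q: "0 < q" unfolding q_def using P_gt_1 by simp
  have d_le: "d \<le> card {i \<in> I. v \<in> line i \<and> line i \<inter> T = {} \<and> k \<le> card (line i \<inter> harmless T)}"
    using many s_eq unfolding d_def by simp
  obtain J where J: "J \<subseteq> {i \<in> I. v \<in> line i \<and> line i \<inter> T = {} \<and> k \<le> card (line i \<inter> harmless T)}"
    and cJ: "card J = d" and finJ: "finite J"
    by (rule obtain_subset_with_card_n[OF d_le])
  have JI: "i \<in> I" "v \<in> line i" "line i \<inter> T = {}" "k \<le> card (line i \<inter> harmless T)" if "i \<in> J" for i
    using J that by auto
  have "\<exists>F. F \<subseteq> line i \<inter> harmless T - {v} \<and> card F = k - 1" if "i \<in> J" for i
  proof -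
    have le: "k - 1 \<le> card (line i \<inter> harmless T - {v})"
      using JI[OF that] v finite_line[OF JI(1)[OF that]] by (simp add: card_Diff_singleton)
    show ?thesis by (rule obtain_subset_with_card_n[OF le]) blast
  qed
  then obtain F where F: "\<And>i. i \<in> J \<Longrightarrow> F i \<subseteq> line i \<inter> harmless T - {v}"
    and cF: "\<And>i. i \<in> J \<Longrightarrow> card (F i) = k - 1" by metis
  have FV: "F i \<subseteq> V" if "i \<in> J" for i using F[OF that] sub by auto
  have finF: "finite (F i)" if "i \<in> J" for i using finite_subset[OF FV[OF that] finite_V] .
  define E where "E i = {S. F i \<subseteq> S \<and> ind (S \<union> T)}" for i
  have single: "W (E i) = q * Z (F i \<union> T)" if "i \<in> J" for i
    unfolding E_def q_def using W_ind_superset[OF FV[OF that]] cF[OF that] by simp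
  have lower: "q * (5/8 * Z T) \<le> W (E i)" if "i \<in> J" for i
    unfolding single[OF that] using q F[OF that] JI[OF that] cF[OF that]
    by (intro mult_left_mono Z_add_collinear) auto
  have pair: "W (E i \<inter> E j) \<le> q * q * Z T" if ij: "i \<in> J" "j \<in> J" "i \<noteq> j" for i j
  proof -
    have "F i \<inter> F j = {}"
      using line_meet[OF JI(1)[OF ij(1)] JI(1)[OF ij(2)] ij(3) _ _ JI(2)[OF ij(1)] JI(2)[OF ij(2)]]
        F[OF ij(1)] F[OF ij(2)] by blast
    then have card: "card (F i \<union> F j) = (k - 1) + (k - 1)"
      using finF cF ij by (simp add: card_Un_disjoint)
    have "E i \<inter> E j = {S. F i \<union> F j \<subseteq> S \<and> ind (S \<union> T)}" unfolding E_def by auto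
    then have "W (E i \<inter> E j) = q * q * Z ((F i \<union> F j) \<union> T)"
      using W_ind_superset[of "F i \<union> F j" T] FV ij card by (simp add: q_def power_add)
    also have "\<dots> \<le> q * q * Z T" using q by (intro mult_left_mono Z_antimono) auto
    finally show ?thesis .
  qed
  \<comment> \<open>There are \<open>d = 1/q\<close> indices \<open>j\<close>, so the off-diagonal terms of a row add up to at most \<open>q * Z T\<close>.\<close>
  have row: "(\<Sum>j\<in>J. W (E i \<inter> E j)) \<le> W (E i) + q * Z T" if i: "i \<in> J" for i
  proof -
    have "(\<Sum>j\<in>J. W (E i \<inter> E j)) = W (E i) + (\<Sum>j\<in>J-{i}. W (E i \<inter> E j))"
      using sum.remove[OF finJ i, of "\<lambda>j. W (E i \<inter> E j)"] by simp
    also have "(\<Sum>j\<in>J-{i}. W (E i \<inter> E j)) \<le> (\<Sum>j\<in>J-{i}. q * q * Z T)"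
      using pair i by (intro sum_mono) auto
    also have "\<dots> \<le> (\<Sum>j\<in>J. q * q * Z T)"
      using finJ q Z_nonneg by (intro sum_mono2) auto
    also have "\<dots> = q * Z T" using cJ dq qd by simp
    finally show ?thesis by simp
  qed
  have "(\<Sum>i\<in>J. \<Sum>j\<in>J. W (E i \<inter> E j)) \<le> (\<Sum>i\<in>J. W (E i) + q * Z T)"
    using row by (intro sum_mono) auto
  also have "\<dots> = (\<Sum>i\<in>J. W (E i)) + Z T"
    using cJ dq qd by (simp add: sum.distrib)
  finally have "2 * (\<Sum>i\<in>J. W (E i)) - Z T \<le> 2 * W (\<Union>i\<in>J. E i)"
    using W_second_moment[OF finJ, of E] by simp
  moreover have "(\<Sum>i\<in>J. q * (5/8 * Z T)) \<le> (\<Sum>i\<in>J. W (E i))"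
    using lower by (intro sum_mono) auto
  moreover have "(\<Sum>i\<in>J. q * (5/8 * Z T)) = 5/8 * Z T"
    using cJ dq qd by simp
  moreover have "W (\<Union>i\<in>J. E i) \<le> W {S. ind (S \<union> T) \<and> \<not> ind (insert v (S \<union> T))}"
  proof (rule W_mono)
    fix S assume "S \<in> (\<Union>i\<in>J. E i)"
    then obtain i where i: "i \<in> J" "F i \<subseteq> S" "ind (S \<union> T)" unfolding E_def by auto
    have "insert v (F i) \<subseteq> insert v (S \<union> T) \<inter> line i"
      using i(2) F[OF i(1)] JI(2)[OF i(1)] by auto
    then have "card (insert v (F i)) \<le> card (insert v (S \<union> T) \<inter> line i)"
      using finite_line[OF JI(1)[OF i(1)]] by (intro card_mono) auto
    moreover have "v \<notin> F i" using F[OF i(1)] by auto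
    then have "card (insert v (F i)) = k"
      using finF[OF i(1)] cF[OF i(1)] k_pos by simp
    ultimately have "\<not> ind (insert v (S \<union> T))"
      using JI(1)[OF i(1)] unfolding ind_def by force
    then show "S \<in> {S. ind (S \<union> T) \<and> \<not> ind (insert v (S \<union> T))}" using i(3) by simp
  qed
  ultimately have "1/4 * Z T < 2 * (\<delta> * Z T)"
    using W_blocked_less[OF v] by linarith
  then have "Z T * (1/4 - 2 * \<delta>) < 0" by (simp add: algebra_simps)
  moreover have "2 * \<delta> \<le> 1/4" using k_ge_3 unfolding \<delta>_def by (simp add: field_simps)
  ultimately show False using Z_nonneg[of T] by (simp add: mult_less_0_iff)
qed

end

section \<open>Counting independent sequences\<close>

lemma card_PiE_insert_filter:
  assumes "finite K" "finite V" "j \<notin> K"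
  shows "card {f \<in> insert j K \<rightarrow>\<^sub>E V. Q f} = (\<Sum>v\<in>V. card {g \<in> K \<rightarrow>\<^sub>E V. Q (g(j := v))})"
proof -
  let ?S = "SIGMA v:V. {g \<in> K \<rightarrow>\<^sub>E V. Q (g(j := v))}"
  have "{f \<in> insert j K \<rightarrow>\<^sub>E V. Q f} = (\<lambda>(v, g). g(j := v)) ` ?S"
    unfolding PiE_insert_eq by auto
  moreover have "inj_on (\<lambda>(v, g). g(j := v)) ?S"
    by (rule inj_on_subset[OF inj_combinator[OF assms(3)]]) auto
  ultimately have "card {f \<in> insert j K \<rightarrow>\<^sub>E V. Q f} = card ?S"
    by (simp add: card_image)
  also have "\<dots> = (\<Sum>v\<in>V. card {g \<in> K \<rightarrow>\<^sub>E V. Q (g(j := v))})"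
    using assms finite_PiE[of K "\<lambda>_. V"] by (intro card_SigmaI) auto
  finally show ?thesis .
qed

context hard_core
begin

lemma \<delta>_bounds: "0 < \<delta>" "\<delta> < 1"
  using k_ge_3 unfolding \<delta>_def by (auto simp: field_simps)

text \<open>Points recorded in \<open>T\<close> each cost a factor \<open>1 - \<delta>\<close>, while \<open>Z T\<close> is at least 1, so there are at most
\<open>fugacity * card V / \<delta>\<close> of them.\<close>
lemma card_fingerprint_le:
  assumes inv: "Z T \<le> (1 - \<delta>) ^ card T * (1 + fugacity) ^ card V" and ind: "ind T"
  shows "1024 * A * card T \<le> card V"
proof -
  have "1 \<le> Z T" by (rule Z_ge_1[OF ind])
  also note inv
  also have "(1 - \<delta>) ^ card T \<le> exp (- \<delta>) ^ card T"
    using \<delta>_bounds exp_ge_add_one_self[of "- \<delta>"] by (intro power_mono) auto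
  also have "(1 + fugacity) ^ card V \<le> exp fugacity ^ card V"
    using fugacity_pos by (intro power_mono exp_ge_add_one_self) auto
  also have "exp (- \<delta>) ^ card T * exp fugacity ^ card V = exp (real (card V) * fugacity - real (card T) * \<delta>)"
    by (simp add: exp_of_nat_mult[symmetric] exp_add[symmetric])
  finally have "real (card T) * \<delta> \<le> real (card V) * fugacity"
    using fugacity_pos by simp
  then have 1: "real (card T) * (real P - 1) \<le> 4 * real k * real (card V)"
    using P_gt_1 k_pos unfolding \<delta>_def fugacity_def by (simp add: field_simps)
  have "4096 * real k * real A \<le> real P - 1"
  proof -
    have "real (4096 * k * A + 1) \<le> real P" using P_big by (intro of_nat_mono) simp
    then show ?thesis by simp
  qed
  then have "real (card T) * (4096 * real k * real A) \<le> real (card T) * (real P - 1)"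
    by (intro mult_left_mono) auto
  then have "4 * real k * (1024 * real A * real (card T)) \<le> 4 * real k * real (card V)"
    using 1 by (simp add: algebra_simps)
  then have "1024 * real A * real (card T) \<le> real (card V)"
    using k_pos by (subst (asm) mult_le_cancel_left_pos) auto
  then have "real (1024 * A * card T) \<le> real (card V)" by simp
  then show ?thesis by (simp only: of_nat_le_iff)
qed

lemma delta_power_le: "(1 - \<delta>) ^ (32 * k) \<le> 1 / 256"
proof -
  have "(1 - \<delta>) ^ (4 * k) \<le> exp (- \<delta>) ^ (4 * k)"
    using \<delta>_bounds exp_ge_add_one_self[of "- \<delta>"] by (intro power_mono) auto
  also have "\<dots> = exp (- 1)"
    using k_pos by (simp add: exp_of_nat_mult[symmetric] \<delta>_def)
  also have "\<dots> \<le> 1 / 2"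
    using exp_ge_add_one_self[of 1] by (simp add: exp_minus field_simps)
  finally have half: "(1 - \<delta>) ^ (4 * k) \<le> 1 / 2" .
  have "(1 - \<delta>) ^ (32 * k) = ((1 - \<delta>) ^ (4 * k)) ^ 8"
    by (simp add: power_mult[symmetric])
  also have "\<dots> \<le> (1 / 2) ^ 8"
    using half \<delta>_bounds by (intro power_mono) auto
  finally show ?thesis by (simp add: power_divide)
qed

text \<open>Induction on the exposed coordinates. The potential \<open>Z T ^ (32 * k)\<close> drops by the factor 256 whenever
a point outside \<open>harmless T\<close> is recorded; a harmless point is not recorded, but there are at most
\<open>card V / 256\<close> choices for it. Either way the sum over the new point gains \<open>1/256\<close>, and both
together \<open>1/128\<close>.\<close>
lemma count_independent:
  assumes "finite K" "T \<subseteq> V" "Z T \<le> (1 - \<delta>) ^ card T * (1 + fugacity) ^ card V"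
  shows "real (card {f \<in> K \<rightarrow>\<^sub>E V. ind (T \<union> f ` (J \<inter> K))})
    \<le> real (card V) ^ card K * (1 / 128) ^ card (J \<inter> K) * Z T ^ (32 * k)"
  using assms
proof (induction K arbitrary: T rule: finite_induct)
  case empty
  show ?case
  proof (cases "ind T")
    case True
    then have "1 \<le> Z T ^ (32 * k)" using Z_ge_1 by (intro one_le_power)
    then show ?thesis using True by simp
  qed (simp add: Z_nonneg)
next
  case (insert j K)
  let ?n = "real (card V)"
  let ?b = "?n ^ card K * (1 / 128) ^ card (J \<inter> K)"
  let ?count = "\<lambda>T. real (card {g \<in> K \<rightarrow>\<^sub>E V. ind (T \<union> g ` (J \<inter> K))})"
  have b: "0 \<le> ?b" by simp
  show ?case
  proof (cases "ind T")
    case False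
    then have "{f \<in> insert j K \<rightarrow>\<^sub>E V. ind (T \<union> f ` (J \<inter> insert j K))} = {}"
      using ind_mono[OF _ Un_upper1] by blast
    then show ?thesis by (simp only: card.empty of_nat_0) (simp add: Z_nonneg)
  next
    case True
    have upd: "(g(j := v)) ` (J \<inter> K) = g ` (J \<inter> K)" for g and v :: 'a
      using insert.hyps by (intro image_cong) auto
    have split: "real (card {f \<in> insert j K \<rightarrow>\<^sub>E V. ind (T \<union> f ` (J \<inter> insert j K))})
       = (\<Sum>v\<in>V. real (card {g \<in> K \<rightarrow>\<^sub>E V. ind (T \<union> (g(j := v)) ` (J \<inter> insert j K))}))"
      by (simp add: card_PiE_insert_filter[OF insert.hyps(1) finite_V insert.hyps(2)])
    show ?thesis
    proof (cases "j \<in> J")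
      case False
      then have "J \<inter> insert j K = J \<inter> K" by auto
      then show ?thesis
        using split upd insert.IH[OF insert.prems] insert.hyps mult_left_mono[of _ _ ?n]
        by (simp add: mult.assoc)
    next
      case j: True
      then have J: "J \<inter> insert j K = insert j (J \<inter> K)" by auto
      have eq: "T \<union> (g(j := v)) ` (J \<inter> insert j K) = insert v T \<union> g ` (J \<inter> K)" for g and v :: 'a
        unfolding J image_insert upd by simp
      have IH: "?count T \<le> ?b * Z T ^ (32 * k)" by (rule insert.IH[OF insert.prems])
      have nonneg: "0 \<le> ?b * Z T ^ (32 * k)" using b Z_nonneg by (meson mult_nonneg_nonneg zero_le_power)
      have harmful: "?count (insert v T) \<le> ?b * Z T ^ (32 * k) * (1 / 256)"
        if v: "v \<in> V" "v \<notin> harmless T" for v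
      proof -
        have drop: "Z (insert v T) \<le> (1 - \<delta>) * Z T" using v unfolding harmless_def by auto
        have "v \<notin> T"
        proof
          assume "v \<in> T"
          then have "\<delta> * Z T \<le> 0" using drop by (simp add: insert_absorb algebra_simps)
          then show False using Z_ge_1[OF True] \<delta>_bounds by (simp add: mult_le_0_iff)
        qed
        moreover have "finite T" using finite_subset[OF insert.prems(1) finite_V] .
        ultimately have card: "card (insert v T) = Suc (card T)" by simp
        have "(1 - \<delta>) * Z T \<le> (1 - \<delta>) * ((1 - \<delta>) ^ card T * (1 + fugacity) ^ card V)"
          using insert.prems(2) \<delta>_bounds by (intro mult_left_mono) auto
        then have "?count (insert v T) \<le> ?b * Z (insert v T) ^ (32 * k)"
          using v(1) insert.prems(1) drop card by (intro insert.IH) (auto simp: mult.assoc)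
        also have "\<dots> \<le> ?b * ((1 - \<delta>) * Z T) ^ (32 * k)"
          using drop Z_nonneg by (intro mult_left_mono[OF _ b] power_mono)
        also have "\<dots> = ?b * Z T ^ (32 * k) * (1 - \<delta>) ^ (32 * k)"
          by (simp add: power_mult_distrib)
        also have "\<dots> \<le> ?b * Z T ^ (32 * k) * (1 / 256)"
          by (rule mult_left_mono[OF delta_power_le nonneg])
        finally show ?thesis .
      qed
      have always: "?count (insert v T) \<le> ?b * Z T ^ (32 * k)" for v
      proof -
        have "?count (insert v T) \<le> ?count T"
          using insert.hyps finite_V finite_PiE[of K "\<lambda>_. V"]
          by (intro of_nat_mono card_mono) (auto elim: ind_mono)
        then show ?thesis using IH by linarith
      qed
      have HV: "harmless T \<subseteq> V" unfolding harmless_def by auto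
      have "real (card {f \<in> insert j K \<rightarrow>\<^sub>E V. ind (T \<union> f ` (J \<inter> insert j K))})
          = (\<Sum>v\<in>V. ?count (insert v T))"
        unfolding split eq ..
      also have "\<dots> = (\<Sum>v\<in>V - harmless T. ?count (insert v T)) + (\<Sum>v\<in>harmless T. ?count (insert v T))"
        using sum.subset_diff[OF HV finite_V] by blast
      also have "\<dots> \<le> (\<Sum>v\<in>V - harmless T. ?b * Z T ^ (32 * k) * (1 / 256)) + (\<Sum>v\<in>harmless T. ?b * Z T ^ (32 * k))"
        using harmful always by (intro add_mono sum_mono) auto
      also have "(\<Sum>v\<in>V - harmless T. ?b * Z T ^ (32 * k) * (1 / 256)) \<le> (\<Sum>v\<in>V. ?b * Z T ^ (32 * k) * (1 / 256))"
        using nonneg finite_V by (intro sum_mono2) auto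
      also have "(\<Sum>v\<in>V. ?b * Z T ^ (32 * k) * (1 / 256)) = ?b * Z T ^ (32 * k) * (?n / 256)" by simp
      also have "(\<Sum>v\<in>harmless T. ?b * Z T ^ (32 * k)) = ?b * Z T ^ (32 * k) * real (card (harmless T))" by simp
      also have "\<dots> \<le> ?b * Z T ^ (32 * k) * (?n / 256)"
      proof (rule mult_left_mono[OF _ nonneg])
        have "256 * card (harmless T) \<le> card V"
          using insert.prems True by (intro harmless_small card_fingerprint_le)
        then show "real (card (harmless T)) \<le> ?n / 256" by linarith
      qed
      finally have "real (card {f \<in> insert j K \<rightarrow>\<^sub>E V. ind (T \<union> f ` (J \<inter> insert j K))})
          \<le> ?b * Z T ^ (32 * k) * (?n / 256) + ?b * Z T ^ (32 * k) * (?n / 256)"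
        by (simp only: add_left_mono add_right_mono)
      also have "\<dots> = ?b * Z T ^ (32 * k) * (?n / 128)" by (simp add: field_simps)
      also have "\<dots> = ?n ^ card (insert j K) * (1 / 128) ^ card (J \<inter> insert j K) * Z T ^ (32 * k)"
        using insert.hyps unfolding J by simp
      finally show ?thesis .
    qed
  qed
qed

end

section \<open>A sparse random set of points\<close>

lemma card_PiE_image_subset:
  assumes "finite L" "K \<subseteq> L" "U \<subseteq> V"
  shows "card {f \<in> L \<rightarrow>\<^sub>E V. f ` K \<subseteq> U} = card U ^ card K * card V ^ (card L - card K)"
proof -
  have "{f \<in> L \<rightarrow>\<^sub>E V. f ` K \<subseteq> U} = (\<Pi>\<^sub>E j\<in>L. if j \<in> K then U else V)"
  proof (intro equalityI subsetI)
    fix f assume "f \<in> (\<Pi>\<^sub>E j\<in>L. if j \<in> K then U else V)"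
    then have f: "\<And>j. j \<in> L \<Longrightarrow> f j \<in> (if j \<in> K then U else V)" and ext: "f \<in> extensional L"
      by (simp_all add: PiE_iff)
    have "f j \<in> V" if "j \<in> L" for j using f[OF that] assms(3) by (auto split: if_split_asm)
    moreover have "f j \<in> U" if "j \<in> K" for j using f[of j] that assms(2) by auto
    ultimately show "f \<in> {f \<in> L \<rightarrow>\<^sub>E V. f ` K \<subseteq> U}" using ext by (auto simp: PiE_iff)
  qed (auto simp: PiE_iff)
  then have "card {f \<in> L \<rightarrow>\<^sub>E V. f ` K \<subseteq> U} = (\<Prod>j\<in>L. if j \<in> K then card U else card V)"
    using assms(1) by (simp add: card_PiE if_distrib)
  also have "\<dots> = card U ^ card (L \<inter> K) * card V ^ card (L - K)"
    using assms(1) by (simp add: prod.If_cases Diff_eq)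
  also have "L \<inter> K = K" using assms(2) by auto
  also have "card (L - K) = card L - card K"
    using assms finite_subset by (intro card_Diff_subset) auto
  finally show ?thesis .
qed

lemma sum_card_swap:
  assumes "finite A" "finite B"
  shows "(\<Sum>a\<in>A. card {b \<in> B. R a b}) = (\<Sum>b\<in>B. card {a \<in> A. R a b})"
  using sum_multicount_gen[OF assms, of R "\<lambda>b. card {a \<in> A. R a b}"] by simp

context hard_core
begin

text \<open>A line meets the values of \<open>f\<close> in more than \<open>k\<close> points only if one of these pairs witnesses it.
Deleting a single position of each such pair is enough to repair \<open>f\<close>.\<close>
definition crowded :: "nat \<Rightarrow> (nat \<Rightarrow> 'a) \<Rightarrow> (nat set \<times> 'i) set" where
  "crowded M f = {p \<in> {K. K \<subseteq> {..<M} \<and> card K = k + 1} \<times> I. f ` fst p \<subseteq> line (snd p)}"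

definition repeats :: "nat \<Rightarrow> (nat \<Rightarrow> 'a) \<Rightarrow> (nat \<times> nat) set" where
  "repeats M f = {p \<in> {(a, b). a < b \<and> b < M}. f (fst p) = f (snd p)}"

lemma finite_repeats_index: "finite {(a, b). a < b \<and> b < (M::nat)}"
  by (rule finite_subset[of _ "{..<M} \<times> {..<M}"]) auto

lemma finite_crowded: "finite (crowded M f)"
  by (rule finite_subset[of _ "Pow {..<M} \<times> I"]) (auto simp: crowded_def finite_I)

lemma finite_repeats: "finite (repeats M f)"
  by (rule finite_subset[OF _ finite_repeats_index[of M]]) (auto simp: repeats_def)

lemma sum_crowded:
  assumes "k < M" and sparse: "32 * s * (M * A) ^ k \<le> card V ^ k"
  shows "16 * (\<Sum>f\<in>{..<M} \<rightarrow>\<^sub>E V. card (crowded M f)) \<le> M * card V ^ M"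
proof -
  let ?\<Omega> = "{..<M} \<rightarrow>\<^sub>E V" and ?Ks = "{K. K \<subseteq> {..<M} \<and> card K = k + 1}" and ?n = "card V"
  have fin: "finite ?\<Omega>" "finite (?Ks \<times> I)" using finite_V finite_I by (auto intro: finite_PiE)
  have "(\<Sum>f\<in>?\<Omega>. card (crowded M f)) = (\<Sum>b\<in>?Ks \<times> I. card {f \<in> ?\<Omega>. f ` fst b \<subseteq> line (snd b)})"
    unfolding crowded_def by (rule sum_card_swap[OF fin])
  also have "\<dots> \<le> (\<Sum>b\<in>?Ks \<times> I. A ^ (k + 1) * ?n ^ (M - (k + 1)))"
  proof (rule sum_mono)
    fix b assume "b \<in> ?Ks \<times> I"
    then have b: "fst b \<subseteq> {..<M}" "card (fst b) = k + 1" "snd b \<in> I" by auto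
    have "card {f \<in> ?\<Omega>. f ` fst b \<subseteq> line (snd b)} = card (line (snd b)) ^ (k + 1) * ?n ^ (M - (k + 1))"
      using card_PiE_image_subset[OF _ b(1) line_subset[OF b(3)]] b(2) by simp
    also have "\<dots> \<le> A ^ (k + 1) * ?n ^ (M - (k + 1))"
      by (intro mult_le_mono1 power_mono card_line b) simp
    finally show "card {f \<in> ?\<Omega>. f ` fst b \<subseteq> line (snd b)} \<le> A ^ (k + 1) * ?n ^ (M - (k + 1))" .
  qed
  also have "\<dots> = card ?Ks * card I * (A ^ (k + 1) * ?n ^ (M - (k + 1)))"
    by (simp add: card_cartesian_product)
  also have "\<dots> \<le> M ^ (k + 1) * card I * (A ^ (k + 1) * ?n ^ (M - (k + 1)))"
    using n_subsets[of "{..<M}" "k + 1"] binomial_le_pow[of "k + 1" M] assms(1)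
    by (intro mult_le_mono1) simp
  also have "\<dots> = (A * card I) * (M * (M * A) ^ k * ?n ^ (M - (k + 1)))"
    by (simp add: power_mult_distrib mult_ac)
  also have "\<dots> \<le> (2 * s * ?n) * (M * (M * A) ^ k * ?n ^ (M - (k + 1)))"
    by (rule mult_le_mono1[OF card_I])
  finally have "16 * (\<Sum>f\<in>?\<Omega>. card (crowded M f)) \<le> 16 * ((2 * s * ?n) * (M * (M * A) ^ k * ?n ^ (M - (k + 1))))"
    by (rule mult_le_mono2)
  also have "\<dots> = (32 * s * (M * A) ^ k) * (M * (?n * ?n ^ (M - (k + 1))))" by (simp add: mult_ac)
  also have "\<dots> \<le> ?n ^ k * (M * (?n * ?n ^ (M - (k + 1))))" by (rule mult_le_mono1[OF sparse])
  also have "\<dots> = M * ?n ^ (k + 1 + (M - (k + 1)))" by (simp only: power_add) (simp add: mult_ac)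
  also have "k + 1 + (M - (k + 1)) = M" using assms(1) by simp
  finally show ?thesis .
qed

lemma sum_repeats:
  assumes "16 * M \<le> card V"
  shows "16 * (\<Sum>f\<in>{..<M} \<rightarrow>\<^sub>E V. card (repeats M f)) \<le> M * card V ^ M"
proof -
  let ?\<Omega> = "{..<M} \<rightarrow>\<^sub>E V" and ?ab = "{(a, b). a < b \<and> b < (M::nat)}" and ?n = "card V"
  have fin: "finite ?\<Omega>" using finite_V by (auto intro: finite_PiE)
  have one: "card {f \<in> ?\<Omega>. f (fst p) = f (snd p)} \<le> ?n * ?n ^ (M - 2)" if "p \<in> ?ab" for p
  proof -
    have p: "{fst p, snd p} \<subseteq> {..<M}" "card {fst p, snd p} = 2" using that by auto
    have "{f \<in> ?\<Omega>. f (fst p) = f (snd p)} = (\<Union>v\<in>V. {f \<in> ?\<Omega>. f ` {fst p, snd p} \<subseteq> {v}})"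
      using p(1) by (auto simp: PiE_iff)
    then have "card {f \<in> ?\<Omega>. f (fst p) = f (snd p)} \<le> (\<Sum>v\<in>V. card {f \<in> ?\<Omega>. f ` {fst p, snd p} \<subseteq> {v}})"
      using card_UN_le[OF finite_V] by simp
    also have "\<dots> = (\<Sum>v\<in>V. ?n ^ (M - 2))"
      using card_PiE_image_subset[of "{..<M}" "{fst p, snd p}" "{v}" V for v] p
      by (intro sum.cong refl) simp
    finally show ?thesis by simp
  qed
  have "(\<Sum>f\<in>?\<Omega>. card (repeats M f)) = (\<Sum>p\<in>?ab. card {f \<in> ?\<Omega>. f (fst p) = f (snd p)})"
    unfolding repeats_def by (rule sum_card_swap[OF fin finite_repeats_index])
  also have "\<dots> \<le> (\<Sum>p\<in>?ab. ?n * ?n ^ (M - 2))"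
    using one by (rule sum_mono)
  also have "\<dots> = card ?ab * (?n * ?n ^ (M - 2))" by simp
  also have "\<dots> \<le> M * M * (?n * ?n ^ (M - 2))"
  proof (rule mult_le_mono1)
    have "?ab \<subseteq> {..<M} \<times> {..<M}" by auto
    then have "card ?ab \<le> card ({..<M} \<times> {..<M})" by (intro card_mono) auto
    then show "card ?ab \<le> M * M" by (simp add: card_cartesian_product)
  qed
  finally have le: "(\<Sum>f\<in>?\<Omega>. card (repeats M f)) \<le> M * M * (?n * ?n ^ (M - 2))" .
  show ?thesis
  proof (cases "2 \<le> M")
    case True
    have "16 * (M * M * (?n * ?n ^ (M - 2))) = (16 * M) * (M * (?n * ?n ^ (M - 2)))" by (simp add: mult_ac)
    also have "\<dots> \<le> ?n * (M * (?n * ?n ^ (M - 2)))" by (rule mult_le_mono1[OF assms])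
    also have "\<dots> = M * ?n ^ (2 + (M - 2))" by (simp only: power_add) (simp add: power2_eq_square mult_ac)
    also have "2 + (M - 2) = M" using True by simp
    finally show ?thesis using le by linarith
  next
    case False
    then have "repeats M f = {}" for f unfolding repeats_def by auto
    then show ?thesis by simp
  qed
qed

text \<open>With this \<open>M\<close> the total potential \<open>(1 + fugacity) ^ (32 * k * card V)\<close> is at most
\<open>exp M \<le> 9 ^ (M div 2)\<close>. The union bound over at most \<open>4 ^ (M div 2)\<close> index sets then leaves the proportion \<open>(4 * 9 / 128) ^ (M div 2)\<close>.\<close>
lemma few_contain_large_independent:
  assumes M: "real M = 32 * real k * real (card V) * fugacity" and even: "even M" and M4: "4 \<le> M"
  shows "4 * card {f \<in> {..<M} \<rightarrow>\<^sub>E V. \<exists>J\<subseteq>{..<M}. 2 * card J = M \<and> ind (f ` J)} \<le> card V ^ M"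
proof -
  let ?\<Omega> = "{..<M} \<rightarrow>\<^sub>E V" and ?n = "card V" and ?Js = "{J. J \<subseteq> {..<M} \<and> 2 * card J = M}"
  obtain m where m: "M = 2 * m" using even by blast
  have fin: "finite ?Js" by simp
  have Z: "Z {} ^ (32 * k) \<le> exp 1 ^ M"
  proof -
    have "Z {} \<le> exp fugacity ^ ?n"
      using Z_le[of "{}"] power_mono[of "1 + fugacity" "exp fugacity" ?n] fugacity_pos
        exp_ge_add_one_self[of fugacity] by linarith
    then have "Z {} ^ (32 * k) \<le> (exp fugacity ^ ?n) ^ (32 * k)"
      using Z_nonneg by (intro power_mono)
    also have "\<dots> = exp (real M)" unfolding M by (simp add: exp_of_nat_mult[symmetric] mult_ac)
    also have "\<dots> = exp 1 ^ M" by (simp add: exp_of_nat_mult[symmetric])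
    finally show ?thesis .
  qed
  have one: "real (card {f \<in> ?\<Omega>. ind (f ` J)}) \<le> real ?n ^ M * (9 / 128) ^ m" if J: "J \<in> ?Js" for J
  proof -
    have JJ: "J \<inter> {..<M} = J" "card J = m" using J m by auto
    have "real (card {f \<in> ?\<Omega>. ind (f ` J)}) \<le> real ?n ^ M * (1 / 128) ^ m * Z {} ^ (32 * k)"
      using count_independent[of "{..<M}" "{}" J] Z_le[of "{}"] JJ by simp
    also have "\<dots> \<le> real ?n ^ M * (1 / 128) ^ m * 3 ^ M"
      using Z power_mono[OF exp_le, of M] by (intro mult_left_mono) auto
    also have "\<dots> = real ?n ^ M * (9 / 128) ^ m"
      unfolding m by (simp add: power_mult power_divide)
    finally show ?thesis .
  qed
  have "{f \<in> ?\<Omega>. \<exists>J\<subseteq>{..<M}. 2 * card J = M \<and> ind (f ` J)} = (\<Union>J\<in>?Js. {f \<in> ?\<Omega>. ind (f ` J)})" by auto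
  then have "card {f \<in> ?\<Omega>. \<exists>J\<subseteq>{..<M}. 2 * card J = M \<and> ind (f ` J)} \<le> (\<Sum>J\<in>?Js. card {f \<in> ?\<Omega>. ind (f ` J)})"
    using card_UN_le[OF fin, of "\<lambda>J. {f \<in> ?\<Omega>. ind (f ` J)}"] by simp
  then have "real (card {f \<in> ?\<Omega>. \<exists>J\<subseteq>{..<M}. 2 * card J = M \<and> ind (f ` J)})
      \<le> (\<Sum>J\<in>?Js. real (card {f \<in> ?\<Omega>. ind (f ` J)}))"
    by (simp only: of_nat_sum[symmetric] of_nat_le_iff)
  also have "\<dots> \<le> (\<Sum>J\<in>?Js. real ?n ^ M * (9 / 128) ^ m)" using one by (rule sum_mono)
  also have "\<dots> = real (card ?Js) * (real ?n ^ M * (9 / 128) ^ m)" by simp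
  also have "\<dots> \<le> 4 ^ m * (real ?n ^ M * (9 / 128) ^ m)"
  proof (rule mult_right_mono)
    have "card ?Js \<le> card (Pow {..<M})" by (rule card_mono) auto
    also have "\<dots> = 4 ^ m" unfolding m by (simp add: card_Pow power_mult)
    finally show "real (card ?Js) \<le> 4 ^ m" by (metis of_nat_le_iff of_nat_numeral of_nat_power)
  qed simp
  also have "\<dots> = real ?n ^ M * (9 / 32) ^ m" by (simp add: power_mult_distrib[symmetric])
  also have "\<dots> \<le> real ?n ^ M * (1 / 4)"
  proof (rule mult_left_mono)
    have "(9 / 32 :: real) ^ m \<le> (9 / 32) ^ 2" using M4 m by (intro power_decreasing) auto
    then show "(9 / 32 :: real) ^ m \<le> 1 / 4" by (simp add: power2_eq_square)
  qed simp
  finally have "real (4 * card {f \<in> ?\<Omega>. \<exists>J\<subseteq>{..<M}. 2 * card J = M \<and> ind (f ` J)}) \<le> real (?n ^ M)" by simp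
  then show ?thesis by (simp only: of_nat_le_iff)
qed

text \<open>Some sequence avoids large independent subsequences and has at most \<open>M/4\<close> defects; delete one position
for each defect.\<close>
lemma exists_configuration:
  assumes M: "real M = 32 * real k * real (card V) * fugacity" and even: "even M" and M4: "4 \<le> M"
    and kM: "k < M" and dilute: "16 * M \<le> card V" and sparse: "32 * s * (M * A) ^ k \<le> card V ^ k"
  shows "\<exists>X\<subseteq>V. 3 * M \<le> 4 * card X \<and> card X \<le> M \<and> (\<forall>i\<in>I. card (X \<inter> line i) \<le> k)
    \<and> (\<forall>Y\<subseteq>X. M \<le> 2 * card Y \<longrightarrow> \<not> ind Y)"
proof -
  let ?\<Omega> = "{..<M} \<rightarrow>\<^sub>E V" and ?n = "card V"
  let ?bad = "{f \<in> ?\<Omega>. \<exists>J\<subseteq>{..<M}. 2 * card J = M \<and> ind (f ` J)}"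
  let ?waste = "\<lambda>f. card (crowded M f) + card (repeats M f)"
  have fin: "finite ?\<Omega>" using finite_V by (auto intro: finite_PiE)
  have cardO: "card ?\<Omega> = ?n ^ M" by (simp add: card_funcsetE)
  have n: "0 < ?n ^ M" using dilute M4 by auto
  have "\<exists>f\<in>?\<Omega> - ?bad. 4 * ?waste f \<le> M"
  proof (rule ccontr)
    assume "\<not> ?thesis"
    then have "(\<Sum>f\<in>?\<Omega> - ?bad. M) \<le> (\<Sum>f\<in>?\<Omega> - ?bad. 4 * ?waste f)"
      by (intro sum_mono) (auto simp: not_le less_imp_le)
    also have "\<dots> \<le> (\<Sum>f\<in>?\<Omega>. 4 * ?waste f)" using fin by (intro sum_mono2) auto
    also have "\<dots> = 4 * (\<Sum>f\<in>?\<Omega>. ?waste f)" by (rule sum_distrib_left[symmetric])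
    also have "(\<Sum>f\<in>?\<Omega>. ?waste f) = (\<Sum>f\<in>?\<Omega>. card (crowded M f)) + (\<Sum>f\<in>?\<Omega>. card (repeats M f))"
      by (rule sum.distrib)
    finally have "card (?\<Omega> - ?bad) * M
        \<le> 4 * ((\<Sum>f\<in>?\<Omega>. card (crowded M f)) + (\<Sum>f\<in>?\<Omega>. card (repeats M f)))"
      by (simp only: sum_constant of_nat_id)
    moreover have "2 * u \<le> w" if "u \<le> 4 * (a + b)" "16 * a \<le> w" "16 * b \<le> w" for a b u w :: nat
      using that by arith
    ultimately have "2 * (card (?\<Omega> - ?bad) * M) \<le> M * ?n ^ M"
      using sum_crowded[OF kM sparse] sum_repeats[OF dilute] by blast
    then have "M * (2 * card (?\<Omega> - ?bad)) \<le> M * ?n ^ M" by (simp only: mult_ac)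
    then have "2 * card (?\<Omega> - ?bad) \<le> ?n ^ M" using M4 by simp
    moreover have "card (?\<Omega> - ?bad) = ?n ^ M - card ?bad"
      using fin cardO by (subst card_Diff_subset) auto
    ultimately show False using few_contain_large_independent[OF M even M4] n by linarith
  qed
  then obtain f where f: "f \<in> ?\<Omega>" "f \<notin> ?bad" and waste: "4 * ?waste f \<le> M" by blast
  define Del where "Del = (\<lambda>(K, i). Min K) ` crowded M f \<union> fst ` repeats M f"
  define L where "L = {..<M} - Del"
  have finDel: "finite Del" unfolding Del_def using finite_crowded finite_repeats by auto
  have "card Del \<le> ?waste f"
    unfolding Del_def
    by (rule le_trans[OF card_Un_le add_mono[OF card_image_le card_image_le]])
       (rule finite_crowded finite_repeats)+
  then have Del: "4 * card Del \<le> M" using waste by arith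
  have finL: "finite L" unfolding L_def by simp
  have cardL: "3 * M \<le> 4 * card L" "card L \<le> M"
    using Del diff_card_le_card_Diff[OF finDel, of "{..<M}"] card_mono[of "{..<M}" L]
    unfolding L_def by auto
  have inj: "inj_on f L"
  proof (rule linorder_inj_onI)
    fix a b assume ab: "a < b" "a \<in> L" "b \<in> L"
    show "f a \<noteq> f b"
    proof
      assume "f a = f b"
      then have "(a, b) \<in> repeats M f" using ab unfolding repeats_def L_def by auto
      then have "a \<in> Del" unfolding Del_def by force
      then show False using ab unfolding L_def by simp
    qed
  qed auto
  have pull: "card {a \<in> L. f a \<in> Y} = card (f ` L \<inter> Y)" "f ` {a \<in> L. f a \<in> Y} = f ` L \<inter> Y" for Y
  proof -
    show "f ` {a \<in> L. f a \<in> Y} = f ` L \<inter> Y" by auto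
    then show "card {a \<in> L. f a \<in> Y} = card (f ` L \<inter> Y)"
      using card_image[OF inj_on_subset[OF inj], of "{a \<in> L. f a \<in> Y}"] by auto
  qed
  show ?thesis
  proof (intro exI[of _ "f ` L"] conjI ballI allI impI)
    show "f ` L \<subseteq> V" using f(1) unfolding L_def by (auto simp: PiE_iff)
    show "3 * M \<le> 4 * card (f ` L)" "card (f ` L) \<le> M"
      using cardL card_image[OF inj] by auto
    show "card (f ` L \<inter> line i) \<le> k" if i: "i \<in> I" for i
    proof (rule ccontr)
      assume "\<not> ?thesis"
      then have big: "k + 1 \<le> card {a \<in> L. f a \<in> line i}" unfolding pull by simp
      obtain K where K: "K \<subseteq> {a \<in> L. f a \<in> line i}" "card K = k + 1" "finite K"
        by (rule obtain_subset_with_card_n[OF big])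
      then have "(K, i) \<in> crowded M f" using i unfolding crowded_def L_def by auto
      then have "Min K \<in> Del" unfolding Del_def by force
      moreover have "Min K \<in> K" using K by (intro Min_in) auto
      ultimately show False using K(1) unfolding L_def by auto
    qed
    show "\<not> ind Y" if Y: "Y \<subseteq> f ` L" "M \<le> 2 * card Y" for Y
    proof
      assume "ind Y"
      have "f ` L \<inter> Y = Y" using Y(1) by auto
      then have le: "M div 2 \<le> card {a \<in> L. f a \<in> Y}" using Y(2) unfolding pull by simp
      obtain J where J: "J \<subseteq> {a \<in> L. f a \<in> Y}" "card J = M div 2" "finite J"
        by (rule obtain_subset_with_card_n[OF le])
      have "ind (f ` J)" using J(1) by (intro ind_mono[OF \<open>ind Y\<close>]) auto
      moreover have "J \<subseteq> {..<M}" "2 * card J = M" using J even unfolding L_def by auto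
      ultimately show False using f by blast
    qed
  qed
qed

end

section \<open>Integer grids in the plane\<close>

text \<open>The index is the pair of slope and intercept. A line given in this way has at most one grid point in each
of the \<open>A\<close> columns, however large \<open>B\<close> is.\<close>
definition grid_line :: "nat \<Rightarrow> nat \<Rightarrow> nat \<times> int \<Rightarrow> (nat \<times> nat) set" where
  "grid_line A B = (\<lambda>(a, b). {(u, w). u < A \<and> w < B \<and> int w = int a * int u + b})"

text \<open>Each point lies on exactly one line of every slope. Intercepts range over an interval of length
\<open>B + A s \<le> 2 B\<close>, which bounds the number of lines.\<close>
lemma grid_regular_line_system:
  assumes "A * s \<le> B" "2048 * k \<le> A" "3 \<le> k"
  shows "regular_line_system ({..<A} \<times> {..<B}) ({..<s} \<times> {- int (A * s)..<int B}) (grid_line A B) s A k"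
proof
  let ?I = "{..<s} \<times> {- int (A * s)..<int B}"
  show "finite ({..<A} \<times> {..<B})" "finite ?I" "2048 * k \<le> A" "3 \<le> k" using assms by auto
  show "grid_line A B i \<subseteq> {..<A} \<times> {..<B}" for i
    unfolding grid_line_def by (auto split: prod.splits)
  show "p = q" if "i \<noteq> j" "p \<in> grid_line A B i" "p \<in> grid_line A B j" "q \<in> grid_line A B i" "q \<in> grid_line A B j"
    for i j p q
  proof -
    obtain a b a' b' u w u' w' where [simp]: "i = (a, b)" "j = (a', b')" "p = (u, w)" "q = (u', w')"
      by (metis surj_pair)
    have e: "int w = int a * int u + b" "int w = int a' * int u + b'"
      "int w' = int a * int u' + b" "int w' = int a' * int u' + b'"
      using that by (auto simp: grid_line_def)
    then have "(int a - int a') * (int u - int u') = 0" by (simp add: algebra_simps)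
    moreover have "int a \<noteq> int a'" using e(1,2) \<open>i \<noteq> j\<close> by auto
    ultimately have "u = u'" by simp
    then show "p = q" using e by simp
  qed
  show "card (grid_line A B i) \<le> A" for i
  proof -
    have "inj_on fst (grid_line A B i)" unfolding grid_line_def inj_on_def by (auto split: prod.splits)
    then have "card (grid_line A B i) = card (fst ` grid_line A B i)" by (simp add: card_image)
    also have "\<dots> \<le> card {..<A}"
      by (rule card_mono) (auto simp: grid_line_def split: prod.splits)
    finally show ?thesis by simp
  qed
  show "card {i \<in> ?I. v \<in> grid_line A B i} = s" if "v \<in> {..<A} \<times> {..<B}" for v
  proof -
    obtain u w where v: "v = (u, w)" "u < A" "w < B" using \<open>v \<in> _\<close> by auto
    have le: "int a * int u \<le> int (A * s)" if "a < s" for a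
      using mult_le_mono[of a s u A] that v(2) by (simp add: mult.commute flip: of_nat_mult)
    have "{i \<in> ?I. v \<in> grid_line A B i} = (\<lambda>a. (a, int w - int a * int u)) ` {..<s}"
    proof (intro equalityI subsetI)
      fix i assume "i \<in> (\<lambda>a. (a, int w - int a * int u)) ` {..<s}"
      then obtain a where a: "a < s" "i = (a, int w - int a * int u)" by auto
      have "0 \<le> int a * int u" by simp
      then have "- int (A * s) \<le> int w - int a * int u" "int w - int a * int u < int B"
        using le[OF a(1)] v(3) by linarith+
      then show "i \<in> {i \<in> ?I. v \<in> grid_line A B i}" using a v by (simp add: grid_line_def)
    qed (auto simp: grid_line_def v(1) image_iff)
    also have "card \<dots> = s" by (subst card_image) (auto simp: inj_on_def)
    finally show ?thesis .
  qed
  have "A * card ?I = A * s * (B + A * s)"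
    by (simp add: card_cartesian_product nat_add_distrib flip: of_nat_mult of_nat_add)
  also have "\<dots> \<le> A * s * (B + B)" using assms(1) by (intro mult_le_mono2) simp
  also have "\<dots> = 2 * s * card ({..<A} \<times> {..<B})" by (simp add: card_cartesian_product algebra_simps)
  finally show "A * card ?I \<le> 2 * s * card ({..<A} \<times> {..<B})" .
qed

definition plane_point :: "nat \<times> nat \<Rightarrow> real ^ 2" where
  "plane_point = (\<lambda>(u, w). vector [real u, real w])"

definition plane_line :: "nat \<times> int \<Rightarrow> (real ^ 2) set" where
  "plane_line = (\<lambda>(a, b). {z. z $ 2 = real a * z $ 1 + real_of_int b})"

lemma inj_plane_point: "inj plane_point"
  by (rule injI) (auto simp: plane_point_def vec_eq_iff forall_2 vector_2)

lemma straight_plane_line: "straight_line (plane_line i)"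
proof -
  obtain a b where i: "i = (a, b)" by fastforce
  let ?p = "vector [0, real_of_int b] :: real ^ 2"
  let ?q = "vector [1, real a + real_of_int b] :: real ^ 2"
  have "?p \<noteq> ?q" by (simp add: vec_eq_iff forall_2)
  moreover have "plane_line i = affine hull {?p, ?q}"
  proof (intro equalityI subsetI)
    fix z assume "z \<in> plane_line i"
    then have "z = (1 - z $ 1) *\<^sub>R ?p + z $ 1 *\<^sub>R ?q"
      by (simp add: i plane_line_def vec_eq_iff forall_2 algebra_simps)
    then show "z \<in> affine hull {?p, ?q}" unfolding affine_hull_2 by force
  next
    fix z assume "z \<in> affine hull {?p, ?q}"
    then obtain u v where z: "z = u *\<^sub>R ?p + v *\<^sub>R ?q" and uv: "u + v = 1"
      unfolding affine_hull_2 by blast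
    have u: "u = 1 - v" using uv by simp
    show "z \<in> plane_line i" unfolding z u by (simp add: i plane_line_def algebra_simps)
  qed
  ultimately show ?thesis
    unfolding straight_line_def by (simp add: aff_dim_affine_hull aff_dim_2)
qed

lemma plane_line_Int:
  assumes "X \<subseteq> {..<A} \<times> {..<B}"
  shows "plane_line i \<inter> plane_point ` X = plane_point ` (X \<inter> grid_line A B i)"
proof -
  have "plane_point p \<in> plane_line i \<longleftrightarrow> p \<in> grid_line A B i" if "p \<in> X" for p
  proof -
    obtain u w a b where "p = (u, w)" "i = (a, b)" by (metis surj_pair)
    moreover have "real w = real a * real u + real_of_int b \<longleftrightarrow> int w = int a * int u + b"
      using of_int_eq_iff[of "int w" "int a * int u + b", where 'a = real] by simp
    ultimately show ?thesis
      using that assms by (auto simp: plane_point_def plane_line_def grid_line_def)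
  qed
  then show ?thesis by auto
qed

text \<open>A line with \<open>k\<close> points in \<open>X - N\<close> has no further point in \<open>X\<close>, so it would be missed by \<open>N\<close>;
hence \<open>X - N\<close> is independent and thus small.\<close>
lemma (in regular_line_system) large_net:
  assumes X: "X \<subseteq> V" and sizes: "3 * M \<le> 4 * card X" and few: "\<And>i. i \<in> I \<Longrightarrow> card (X \<inter> line i) \<le> k"
    and dep: "\<And>Y. Y \<subseteq> X \<Longrightarrow> M \<le> 2 * card Y \<Longrightarrow> \<not> ind Y"
    and N: "N \<subseteq> X" and hit: "\<And>i. i \<in> I \<Longrightarrow> k \<le> card (X \<inter> line i) \<Longrightarrow> N \<inter> line i \<noteq> {}"
  shows "card X \<le> 3 * card N"
proof -
  have finX: "finite X" using finite_subset[OF X finite_V] .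
  have "ind (X - N)"
    unfolding ind_def
  proof (rule ballI, rule ccontr)
    fix i assume i: "i \<in> I" and "\<not> card ((X - N) \<inter> line i) < k"
    then have ge: "k \<le> card ((X - N) \<inter> line i)" by simp
    have sub: "(X - N) \<inter> line i \<subseteq> X \<inter> line i" by auto
    have fin: "finite (X \<inter> line i)" using finX by simp
    have "card (X \<inter> line i) \<le> card ((X - N) \<inter> line i)" using few[OF i] ge by linarith
    then have "(X - N) \<inter> line i = X \<inter> line i" by (rule card_seteq[OF fin sub])
    then have "N \<inter> line i = {}" using N by auto
    moreover have "k \<le> card (X \<inter> line i)" using ge card_mono[OF fin sub] by linarith
    ultimately show False using hit[OF i] by blast
  qed
  then have "2 * card (X - N) < M" using dep[of "X - N"] by (meson Diff_subset not_le)
  moreover have "card (X - N) = card X - card N"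
    using finite_subset[OF N finX] N by (rule card_Diff_subset)
  ultimately show ?thesis using sizes by arith
qed

section \<open>The lower bound for nets\<close>

lemma grid_hard_core:
  assumes k: "2 ^ 20 \<le> k"
    and A: "A = 2048 * k" and P: "P = k ^ (4 * k)" and s: "s = 2 * P ^ (k - 1)" and B: "B = A * s * (P - 1)"
  shows "hard_core ({..<A} \<times> {..<B}) ({..<s} \<times> {- int (A * s)..<int B}) (grid_line A B) s A k P"
    and "2 \<le> P"
proof -
  have "2 ^ 20 * k ^ 3 \<le> k * k ^ 3" using k by (intro mult_le_mono1)
  also have "\<dots> = k ^ 4" by (simp add: power_Suc[symmetric] del: power_Suc)
  also have "\<dots> \<le> P" unfolding P using k by (intro power_increasing) auto
  finally have P_ge: "2 ^ 20 * k ^ 3 \<le> P" .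
  have "2 ^ 23 * k ^ 2 < 2 ^ 20 * (2 ^ 20 * k ^ 2)" using k by simp
  also have "\<dots> \<le> 2 ^ 20 * (k * k ^ 2)" using k by (intro mult_le_mono2 mult_le_mono1)
  also have "\<dots> = 2 ^ 20 * k ^ 3" by (simp add: power3_eq_cube power2_eq_square)
  finally have big: "4096 * k * A < P" using P_ge unfolding A by (simp add: power2_eq_square)
  have "0 < k" using k by auto
  then have "0 < 4096 * k * A" unfolding A by simp
  then show P2: "2 \<le> P" using big by linarith
  have "A * s * 1 \<le> B" unfolding B using P2 by (intro mult_le_mono2) simp
  then interpret regular_line_system "{..<A} \<times> {..<B}" "{..<s} \<times> {- int (A * s)..<int B}" "grid_line A B" s A k
    using k A by (intro grid_regular_line_system) auto
  show "hard_core ({..<A} \<times> {..<B}) ({..<s} \<times> {- int (A * s)..<int B}) (grid_line A B) s A k P"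
    by unfold_locales (use big s in auto)
qed

text \<open>This makes the expected number of \<open>k + 1\<close> collinear chosen points small: \<open>P = k ^ (4 * k)\<close> beats the
\<open>k\<close>-th power of the loss \<open>2 ^ 16 * k ^ 2\<close>, since the right side has one more factor of size about \<open>P\<close> than the left.\<close>
lemma sparse_parameters:
  assumes k: "2 ^ 20 \<le> k" and P: "P = k ^ (4 * k)" "2 \<le> P"
  shows "64 * P ^ (k - 1) * (2 ^ 16 * k ^ 2) ^ k \<le> (P - 1) ^ k"
proof -
  have kpos: "0 < k" using k by auto
  have "2 ^ k * (64 * P ^ (k - 1) * (2 ^ 16 * k ^ 2) ^ k) = 64 * P ^ (k - 1) * (2 * (2 ^ 16 * k ^ 2)) ^ k"
    by (simp only: power_mult_distrib mult_ac)
  also have "\<dots> \<le> 2 ^ k * P ^ (k - 1) * (2 * (2 ^ 16 * k ^ 2)) ^ k"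
  proof (intro mult_le_mono1)
    have "(2::nat) ^ 6 \<le> 2 ^ k" using k by (intro power_increasing) auto
    then show "(64::nat) \<le> 2 ^ k" by simp
  qed
  also have "\<dots> = P ^ (k - 1) * (2 * (2 * (2 ^ 16 * k ^ 2))) ^ k"
    by (simp only: power_mult_distrib mult_ac)
  also have "2 * (2 * (2 ^ 16 * k ^ 2)) = 2 ^ 18 * k ^ 2" by simp
  also have "P ^ (k - 1) * (2 ^ 18 * k ^ 2) ^ k \<le> P ^ (k - 1) * (k ^ 4) ^ k"
  proof (intro mult_le_mono2 power_mono)
    have "2 ^ 18 * k ^ 2 \<le> (k * k) * k ^ 2"
      using k mult_le_mono[of "2 ^ 20" k 1 k] by (intro mult_le_mono1) simp
    also have "\<dots> = k ^ 4" by (simp add: power_numeral_reduce mult_ac)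
    finally show "2 ^ 18 * k ^ 2 \<le> k ^ 4" .
  qed simp
  also have "\<dots> = P ^ (k - 1) * P" unfolding P by (simp only: power_mult)
  also have "\<dots> = P ^ k" using kpos by (metis power_minus_mult)
  also have "\<dots> \<le> (2 * (P - 1)) ^ k" using P(2) by (intro power_mono) auto
  also have "\<dots> = 2 ^ k * (P - 1) ^ k" by (rule power_mult_distrib)
  finally show ?thesis by simp
qed

theorem theorem1p3:
  fixes \<epsilon>\<^sub>0 :: real
  assumes "\<epsilon>\<^sub>0 > 0"
  shows "\<exists>\<epsilon>::real. \<exists>X :: (real ^ 2) set.
           0 < \<epsilon> \<and> \<epsilon> < \<epsilon>\<^sub>0 \<and> finite X \<and> X \<noteq> {} \<and>
           real (eps_net_number \<epsilon> X (line_ranges X))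
             \<ge> 1 / (80 * \<epsilon>) * sqrt (ln (1 / \<epsilon>) / ln (ln (1 / \<epsilon>)))"
proof -
  obtain k0 :: nat where k0: "1 / \<epsilon>\<^sub>0 < real k0" using reals_Archimedean2 by blast
  define k where "k = max k0 (2 ^ 20)"
  define A where "A = 2048 * k"
  define P where "P = k ^ (4 * k)"
  define s where "s = 2 * P ^ (k - 1)"
  define B where "B = A * s * (P - 1)"
  \<comment> \<open>\<open>B\<close> contains the factor \<open>P - 1\<close> to make \<open>M = 32 * k * fugacity * (A * B)\<close> an integer.\<close>
  define M where "M = 32 * k * A ^ 2 * s"
  let ?V = "{..<A} \<times> {..<B}" and ?I = "{..<s} \<times> {- int (A * s)..<int B}"
  have k: "2 ^ 20 \<le> k" "k0 \<le> k" unfolding k_def by auto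
  have kpos: "0 < k" using k by auto
  interpret hard_core ?V ?I "grid_line A B" s A k P
    by (rule grid_hard_core[OF k(1) A_def P_def s_def B_def])
  have P2: "2 \<le> P" by (rule grid_hard_core[OF k(1) A_def P_def s_def B_def])
  have pos: "0 < A" "0 < s" "0 < P" using kpos P2 unfolding A_def s_def by auto
  have cardV: "card ?V = A ^ 2 * s * (P - 1)"
    unfolding B_def by (simp add: card_cartesian_product power2_eq_square)
  have kP: "k \<le> P" unfolding P_def using kpos by (simp add: self_le_power)
  have big_M: "2 * (k * P) \<le> M"
  proof -
    have "P ^ 1 \<le> P ^ (k - 1)" using k P2 by (intro power_increasing) auto
    then have "2 * k * 1 * P \<le> 32 * k * A ^ 2 * s"
      using pos unfolding s_def by (intro mult_le_mono) auto
    then show ?thesis unfolding M_def by simp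
  qed
  have "\<exists>X\<subseteq>?V. 3 * M \<le> 4 * card X \<and> card X \<le> M \<and> (\<forall>i\<in>?I. card (X \<inter> grid_line A B i) \<le> k)
    \<and> (\<forall>Y\<subseteq>X. M \<le> 2 * card Y \<longrightarrow> \<not> ind Y)"
  proof (rule exists_configuration)
    show "real M = 32 * real k * real (card ?V) * fugacity"
      unfolding M_def cardV fugacity_def using P2 by (simp add: of_nat_diff)
    show "even M" unfolding M_def by simp
    have "1 * P \<le> k * P" using kpos by (intro mult_le_mono1) simp
    then show "4 \<le> M" using big_M P2 by linarith
    have "k * 2 \<le> k * P" using P2 by (intro mult_le_mono2)
    then show "k < M" using big_M kpos by linarith
    have "512 * k \<le> P - 1"
    proof -
      have "512 * k * 1 \<le> 4096 * k * A" using pos by (intro mult_le_mono) auto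
      then show ?thesis using P_big by linarith
    qed
    then have "A ^ 2 * s * (512 * k) \<le> A ^ 2 * s * (P - 1)" by (intro mult_le_mono2)
    then show "16 * M \<le> card ?V" unfolding cardV M_def by (simp add: mult_ac)
    have "M * A = A ^ 2 * s * (2 ^ 16 * k ^ 2)"
      unfolding M_def A_def by (simp add: power2_eq_square)
    then have "32 * s * (M * A) ^ k = (A ^ 2 * s) ^ k * (64 * P ^ (k - 1) * (2 ^ 16 * k ^ 2) ^ k)"
      by (simp only: power_mult_distrib) (simp add: s_def mult_ac)
    also have "\<dots> \<le> (A ^ 2 * s) ^ k * (P - 1) ^ k"
      by (intro mult_le_mono2 sparse_parameters k P_def P2)
    also have "\<dots> = card ?V ^ k" unfolding cardV by (rule power_mult_distrib[symmetric])
    finally show "32 * s * (M * A) ^ k \<le> card ?V ^ k" .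
  qed
  then obtain X where X: "X \<subseteq> ?V" "3 * M \<le> 4 * card X" "card X \<le> M"
    "\<And>i. i \<in> ?I \<Longrightarrow> card (X \<inter> grid_line A B i) \<le> k"
    "\<And>Y. Y \<subseteq> X \<Longrightarrow> M \<le> 2 * card Y \<Longrightarrow> \<not> ind Y"
    by blast
  define n where "n = card X"
  define \<epsilon> where "\<epsilon> = real k / real n"
  define X' where "X' = plane_point ` X"
  have finX: "finite X" using finite_subset[OF X(1)] by auto
  have card_image': "card (plane_point ` Y) = card Y" for Y
    using card_image[OF inj_on_subset[OF inj_plane_point subset_UNIV]] .
  have n_ge: "k * P \<le> n" using X(2) big_M unfolding n_def by linarith
  have npos: "0 < n" using n_ge kpos pos by (metis mult_pos_pos not_le bot_nat_0.not_eq_extremum)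
  have \<epsilon>_pos: "0 < \<epsilon>" unfolding \<epsilon>_def using npos kpos by simp
  have finX': "finite X'" "X' \<noteq> {}" unfolding X'_def using finX npos unfolding n_def by auto
  have cardX': "card X' = n" unfolding X'_def n_def by (rule card_image')
  have inv: "1 / \<epsilon> = real n / real k" unfolding \<epsilon>_def by simp
  have inv_ge: "real P \<le> 1 / \<epsilon>"
  proof -
    have "real k * real P \<le> real n" using n_ge by (metis of_nat_le_iff of_nat_mult)
    then show ?thesis unfolding inv using kpos by (simp add: field_simps)
  qed
  have "\<epsilon> < \<epsilon>\<^sub>0"
  proof -
    have "1 / \<epsilon>\<^sub>0 < real P" using k0 k(2) kP by linarith
    then have "1 / \<epsilon>\<^sub>0 < 1 / \<epsilon>" using inv_ge by linarith
    then show ?thesis using assms \<epsilon>_pos by (simp add: field_simps)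
  qed
  obtain N where N: "eps_net \<epsilon> X' (line_ranges X') N" and cardN: "card N = eps_net_number \<epsilon> X' (line_ranges X')"
    using eps_net_number_attained[OF finX' \<epsilon>_pos, of "line_ranges X'"] unfolding line_ranges_def by blast
  have net: "n \<le> 3 * card N"
  proof -
    define N0 where "N0 = {p \<in> X. plane_point p \<in> N}"
    have N_eq: "N = plane_point ` N0" using N unfolding eps_net_def X'_def N0_def by auto
    have "card X \<le> 3 * card N0"
    proof (rule large_net[OF X(1,2)])
      fix i assume "i \<in> ?I" and rich: "k \<le> card (X \<inter> grid_line A B i)"
      let ?R = "plane_line i \<inter> X'"
      have R: "?R = plane_point ` (X \<inter> grid_line A B i)"
        unfolding X'_def by (rule plane_line_Int[OF X(1)])
      have "?R \<in> line_ranges X'" unfolding line_ranges_def using straight_plane_line by blast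
      moreover have "\<epsilon> * real (card X') \<le> real (card ?R)"
        unfolding R card_image' cardX' \<epsilon>_def using rich npos by simp
      ultimately have "N \<inter> ?R \<noteq> {}" using N unfolding eps_net_def by blast
      then show "N0 \<inter> grid_line A B i \<noteq> {}"
        unfolding R N_eq using inj_plane_point by (auto dest: injD)
    qed (use X in \<open>auto simp: N0_def\<close>)
    then show ?thesis unfolding n_def N_eq card_image' .
  qed
  let ?L = "ln (1 / \<epsilon>)"
  have lnk: "1 \<le> ln (real k)"
  proof -
    have "3 \<le> k" using k(1) by simp
    then have "exp 1 \<le> real k" using exp_le by linarith
    then show ?thesis using kpos by (simp add: ln_ge_iff)
  qed
  have L_ge: "real k \<le> ?L"
  proof -
    have "real k * 1 \<le> real (4 * k) * ln (real k)" using lnk by (intro mult_mono) auto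
    also have "\<dots> = ln (real P)" unfolding P_def using kpos by (simp add: ln_realpow)
    also have "\<dots> \<le> ?L" using inv_ge pos \<epsilon>_pos by (intro ln_mono) auto
    finally show ?thesis by simp
  qed
  have lnL: "ln (real k) \<le> ln ?L" using L_ge kpos by (intro ln_mono) auto
  have "M \<le> k ^ (5 * k ^ 2)"
  proof -
    have "M = 2 ^ 28 * k ^ 3 * P ^ (k - 1)"
      unfolding M_def A_def s_def by (simp add: power2_eq_square power3_eq_cube)
    also have "\<dots> \<le> (k ^ 2) * k ^ 3 * P ^ (k - 1)"
    proof (intro mult_le_mono1)
      have "(2 ^ 20) ^ 2 \<le> k ^ 2" using k(1) by (intro power_mono) auto
      then show "2 ^ 28 \<le> k ^ 2" by simp
    qed
    also have "\<dots> = k ^ (5 + 4 * k * (k - 1))" unfolding P_def by (simp add: power_add power_mult)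
    also have "\<dots> \<le> k ^ (5 * k ^ 2)"
    proof (rule power_increasing)
      have "2 \<le> k" using k(1) by simp
      then obtain j where "k = 2 + j" using le_Suc_ex by blast
      then show "5 + 4 * k * (k - 1) \<le> 5 * k ^ 2" by (simp add: power2_eq_square algebra_simps)
    qed (use kpos in auto)
    finally show ?thesis .
  qed
  then have "n \<le> k ^ (5 * k ^ 2)" using X(3) unfolding n_def by linarith
  then have n_le: "real n \<le> real k ^ (5 * k ^ 2)" by (metis of_nat_le_iff of_nat_power)
  have "?L \<le> ln (real n)"
    unfolding inv using npos kpos by (intro ln_mono) (auto simp: field_simps)
  also have "\<dots> \<le> ln (real k ^ (5 * k ^ 2))" using n_le npos by (intro ln_mono) auto
  also have "\<dots> = 5 * real k ^ 2 * ln (real k)" using kpos by (simp add: ln_realpow)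
  also have "\<dots> \<le> (3 * real k) ^ 2 * ln ?L"
    using lnL lnk by (intro mult_mono) (auto simp: power_mult_distrib)
  finally have "?L / ln ?L \<le> (3 * real k) ^ 2" using lnk lnL by (simp add: divide_le_eq)
  then have "sqrt (?L / ln ?L) \<le> 3 * real k" by (intro real_le_lsqrt) auto
  then have "1 / (80 * \<epsilon>) * sqrt (?L / ln ?L) \<le> 1 / (80 * \<epsilon>) * (3 * real k)"
    using \<epsilon>_pos by (intro mult_left_mono) auto
  also have "\<dots> = 3 / 80 * real n" unfolding \<epsilon>_def using kpos by (simp add: field_simps)
  also have "\<dots> \<le> real (card N)" using net by linarith
  finally have "1 / (80 * \<epsilon>) * sqrt (?L / ln ?L) \<le> real (eps_net_number \<epsilon> X' (line_ranges X'))"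
    unfolding cardN .
  then show ?thesis using \<epsilon>_pos \<open>\<epsilon> < \<epsilon>\<^sub>0\<close> finX' by blast
qed

end
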